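(* Let $f^\circ=\mathbb 1_{[0,1)}$, $R>0$, let $0<s_\star<s^\star$ and let $\mathcal A$ be a set of strictly positive, non-increasing sequences bounded by $1$ with $\{(\exp(-j^{s}))_{j\in\mathbb N}:s\in[s_\star,s^\star]\}\subseteq\mathcal A$. Assume $|\varphi_j|\sim j^{-p}$ for some $p>1/2$. Then for every $\alpha\in(0,1)$ there exist $n_\circ\in\mathbb N$ and $\underline A_\alpha\in(0,\infty)$ such that for all $n\ge n_\circ$ and $A\in[0,\underline A_\alpha]$, $$\inf_\Delta\sup_{a\in\mathcal A}\mathcal R\big(\Delta\mid\mathcal E_a^R,A\rho_a(\delta n)\big)\ge1-\alpha,\qquad\delta:=(\log\log\log n\vee1)^{-1/2},$$ the infimum being over all tests $\Delta$.
   Context: Identify the circle with $[0,1)$. $L^2:=L^2([0,1))$ is the space of square-integrable complex-valued functions on $[0,1)$ with $\langle h_1,h_2\rangle=\int_0^1h_1\overline{h_2}$ and norm $\|\cdot\|_{L^2}$. $e_j(x):=\exp(-\mathrm i2\pi jx)$, $h_j:=\langle h,e_j\rangle$ for $j\in\mathbb Z$. $\mathcal D$ is the set of real-valued probability densities on $[0,1)$ in $L^2$. Circular convolution $(f\circledast\varphi)(y)=\int_0^1f(y-s-\lfloor y-s\rfloor)\varphi(s)ds$. The error density $\varphi\in\mathcal D$ is fixed with $|\varphi_j|>0$ for all $j\in\mathbb Z$; $|\varphi_j|\sim j^{-p}$ means there are constants $0<c\le C$ with $cj^{-p}\le|\varphi_j|\le Cj^{-p}$ for all $j\in\mathbb N$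 (recall $|\varphi_{-j}|=|\varphi_j|$). For $f\in\mathcal D$, $Y_1,\dots,Y_n$ i.i.d. with density $f\circledast\varphi$, joint law $\mathbb P_f$; a test is a measurable $\{0,1\}$-valued function of $(Y_1,\dots,Y_n)$. $[k]:=\{1,\dots,k\}$, $\nu_k:=(\sum_{|j|\in[k]}|\varphi_j|^{-4})^{1/4}$. $\rho_a(x):=\big(\min_{k\in\mathbb N}(a_k^2\vee\nu_k^2/x)\big)^{1/2}$ for $x>0$. $\mathcal E_a^R:=\{h\in L^2:2\sum_{j\in\mathbb N}a_j^{-2}|h_j|^2\le R^2\}$. Risk: $\mathcal R(\Delta\mid\mathcal E,\rho):=\mathbb P_{f^\circ}(\Delta=1)+\sup\{\mathbb P_f(\Delta=0):f\in\mathcal D,f-f^\circ\in\mathcal E,\|f-f^\circ\|_{L^2}\ge\rho\}$. *)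

theory Defs
  imports "HOL-Probability.Probability"
begin

text \<open>The circle is identified with [0,1); U is Lebesgue measure on [0,1).\<close>
abbreviation U :: "real measure" where
  "U \<equiv> lebesgue_on {0..<1}"

text \<open>Fourier coefficient h_j = <h, e_j> = int_0^1 h(x) exp(i 2 pi j x) dx
  (e_j(x) = exp(-i 2 pi j x)), for real-valued h.\<close>
definition fcoef :: "(real \<Rightarrow> real) \<Rightarrow> int \<Rightarrow> complex" where
  "fcoef h j = (LINT x|U. complex_of_real (h x) * cis (2 * pi * real_of_int j * x))"

definition L2norm :: "(real \<Rightarrow> real) \<Rightarrow> real" where
  "L2norm h = sqrt (LINT x|U. (h x)\<^sup>2)"

definition dens_set :: "(real \<Rightarrow> real) set" where
  "dens_set = {f. f \<in> borel_measurable U \<and> (\<forall>x\<in>{0..<1}. 0 \<le> f x)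
      \<and> integrable U f \<and> (LINT x|U. f x) = 1 \<and> integrable U (\<lambda>x. (f x)\<^sup>2)}"

definition circ_conv :: "(real \<Rightarrow> real) \<Rightarrow> (real \<Rightarrow> real) \<Rightarrow> real \<Rightarrow> real" where
  "circ_conv f \<phi> y = (LINT s|U. f (y - s - of_int \<lfloor>y - s\<rfloor>) * \<phi> s)"

definition obs_law :: "(real \<Rightarrow> real) \<Rightarrow> (real \<Rightarrow> real) \<Rightarrow> real measure" where
  "obs_law \<phi> f = density U (\<lambda>y. ennreal (circ_conv f \<phi> y))"

definition joint_law :: "nat \<Rightarrow> (real \<Rightarrow> real) \<Rightarrow> (real \<Rightarrow> real) \<Rightarrow> (nat \<Rightarrow> real) measure" where
  "joint_law n \<phi> f = PiM {..<n} (\<lambda>_. obs_law \<phi> f)"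

text \<open>Tests: measurable {0,1}-valued (here: bool-valued, True = 1) functions of (Y_1..Y_n).\<close>
definition tests :: "nat \<Rightarrow> ((nat \<Rightarrow> real) \<Rightarrow> bool) set" where
  "tests n = {\<Delta>. \<Delta> \<in> PiM {..<n} (\<lambda>_. U) \<rightarrow>\<^sub>M count_space UNIV}"

definition f_null :: "real \<Rightarrow> real" where
  "f_null = indicator {0..<1}"

definition ellipsoid :: "(nat \<Rightarrow> real) \<Rightarrow> real \<Rightarrow> (real \<Rightarrow> real) set" where
  "ellipsoid a R = {h. 2 * (\<Sum>j. ennreal ((cmod (fcoef h (int (Suc j))))\<^sup>2 / (a (Suc j))\<^sup>2))
                        \<le> ennreal (R\<^sup>2)}"

definition nu :: "(real \<Rightarrow> real) \<Rightarrow> nat \<Rightarrow> real" where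
  "nu \<phi> k = (\<Sum>j\<in>{-int k..int k} - {0}. 1 / (cmod (fcoef \<phi> j)) ^ 4) powr (1/4)"

text \<open>rho_a(x) = (min_{k in N} max(a_k^2, nu_k^2/x))^{1/2}; the minimum is attained,
  and is written as an infimum over k >= 1.\<close>
definition rho :: "(real \<Rightarrow> real) \<Rightarrow> (nat \<Rightarrow> real) \<Rightarrow> real \<Rightarrow> real" where
  "rho \<phi> a x = sqrt (INF k\<in>{1..}. max ((a k)\<^sup>2) ((nu \<phi> k)\<^sup>2 / x))"

text \<open>Risk R(Delta | E_a^R, rho); the supremum is in [0,\<infinity>] (empty sup = 0).\<close>
definition risk :: "nat \<Rightarrow> (real \<Rightarrow> real) \<Rightarrow> ((nat \<Rightarrow> real) \<Rightarrow> bool) \<Rightarrow> (nat \<Rightarrow> real)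
                     \<Rightarrow> real \<Rightarrow> real \<Rightarrow> ennreal" where
  "risk n \<phi> \<Delta> a R r =
     emeasure (joint_law n \<phi> f_null) {\<omega> \<in> space (joint_law n \<phi> f_null). \<Delta> \<omega>}
     + (SUP f\<in>{f\<in>dens_set. (\<lambda>x. f x - f_null x) \<in> ellipsoid a R
                              \<and> L2norm (\<lambda>x. f x - f_null x) \<ge> r}.
          emeasure (joint_law n \<phi> f) {\<omega> \<in> space (joint_law n \<phi> f). \<not> \<Delta> \<omega>})"

end

theory Submission
  imports Defs "HOL-Real_Asymp.Real_Asymp"
begin

text \<open>
  The null is tested against a mixture over dyadic levels \<open>k = 2\<^sup>m\<close>. On the block \<open>k/2 < j \<le> k\<close> all
  Fourier coefficients are set to \<open>\<plusminus>\<theta>\<close> with independent uniform signs, where \<open>k \<theta>\<^sup>2 = B\<^sup>2 \<nu>\<^sub>k\<^sup>2 / (\<delta> n)\<close>. The smoothness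
  \<open>s\<close> attached to the level solves \<open>exp(-2 k\<^sup>s) = \<nu>\<^sub>k\<^sup>2 / (\<delta> n)\<close>, so that \<open>\<rho>\<^sub>a(\<delta> n)\<^sup>2 \<le> \<nu>\<^sub>k\<^sup>2 / (\<delta> n)\<close> for the
  corresponding sequence \<open>a\<close>. Since \<open>ln k = (ln ln n - O(1)) / s\<close>, the interval \<open>[s_lo, s_hi]\<close> leaves room for
  a number \<open>M\<close> of levels of order \<open>ln ln n\<close>. Different blocks are orthogonal, so only the diagonal contributes to the
  second moment of the mixed likelihood ratio, which is at most
  \<open>1 + exp(G B\<^sup>4 / \<delta>\<^sup>2) / M\<close>; for small \<open>B\<close> the numerator is at most \<open>(ln ln n)\<^bsup>1/2\<^esup>\<close>.
\<close>

subsection \<open>Likelihood ratios and sign mixtures\<close>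

text \<open>A product measure is determined by its values on boxes, and on a box the integrand
  splits into one factor per coordinate.\<close>

lemma PiM_density:
  fixes f :: "'a \<Rightarrow> ennreal"
  assumes I: "finite I" and M: "sigma_finite_measure M" and f[measurable]: "f \<in> borel_measurable M"
    and D: "sigma_finite_measure (density M f)"
  shows "PiM I (\<lambda>_. density M f) = density (PiM I (\<lambda>_. M)) (\<lambda>\<omega>. \<Prod>i\<in>I. f (\<omega> i))"
proof -
  interpret M: product_sigma_finite "\<lambda>_. M" using M by (simp add: product_sigma_finite_def)
  interpret D: product_sigma_finite "\<lambda>_. density M f" using D by (simp add: product_sigma_finite_def)
  show ?thesis
  proof (rule D.PiM_eqI[OF I, symmetric])
    show "sets (density (PiM I (\<lambda>_. M)) (\<lambda>\<omega>. \<Prod>i\<in>I. f (\<omega> i))) = sets (PiM I (\<lambda>_. density M f))"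
      by (simp, intro sets_PiM_cong) auto
    fix A assume A: "\<And>i. i \<in> I \<Longrightarrow> A i \<in> sets (density M f)"
    then have A'[measurable]: "\<And>i. i \<in> I \<Longrightarrow> A i \<in> sets M" by simp
    have "emeasure (density (PiM I (\<lambda>_. M)) (\<lambda>\<omega>. \<Prod>i\<in>I. f (\<omega> i))) (Pi\<^sub>E I A)
        = (\<integral>\<^sup>+\<omega>. (\<Prod>i\<in>I. f (\<omega> i)) * indicator (Pi\<^sub>E I A) \<omega> \<partial>PiM I (\<lambda>_. M))"
      using I A' by (intro emeasure_density sets_PiM_I_finite) auto
    also have "\<dots> = (\<integral>\<^sup>+\<omega>. (\<Prod>i\<in>I. f (\<omega> i) * indicator (A i) (\<omega> i)) \<partial>PiM I (\<lambda>_. M))"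
    proof (rule nn_integral_cong)
      fix \<omega> assume "\<omega> \<in> space (PiM I (\<lambda>_. M))"
      then have e: "\<omega> \<in> extensional I" by (simp add: space_PiM PiE_def)
      show "(\<Prod>i\<in>I. f (\<omega> i)) * indicator (Pi\<^sub>E I A) \<omega> = (\<Prod>i\<in>I. f (\<omega> i) * indicator (A i) (\<omega> i))"
      proof (cases "\<omega> \<in> Pi\<^sub>E I A")
        case True
        then have "\<omega> i \<in> A i" if "i \<in> I" for i using that by auto
        with True show ?thesis by (auto intro!: prod.cong)
      next
        \<comment> \<open>Points of the product space are extensional, so a point outside the box
          fails in some coordinate of \<open>I\<close>, where the product has a zero factor.\<close>
        case False
        then obtain i where "i \<in> I" "\<omega> i \<notin> A i" using e by (auto simp: PiE_def)
        then have "(\<Prod>i\<in>I. f (\<omega> i) * indicator (A i) (\<omega> i)) = 0"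
          using I by (intro prod_zero) (auto intro!: bexI[of _ i])
        with False show ?thesis by simp
      qed
    qed
    also have "\<dots> = (\<Prod>i\<in>I. \<integral>\<^sup>+x. f x * indicator (A i) x \<partial>M)"
      using I A' by (intro M.product_nn_integral_prod) auto
    also have "\<dots> = (\<Prod>i\<in>I. emeasure (density M f) (A i))"
      using A' by (intro prod.cong) (auto simp: emeasure_density)
    finally show "emeasure (density (PiM I (\<lambda>_. M)) (\<lambda>\<omega>. \<Prod>i\<in>I. f (\<omega> i))) (Pi\<^sub>E I A)
      = (\<Prod>i\<in>I. emeasure (density M f) (A i))" .
  qed
qed

text \<open>Uses \<open>\<bar>z\<bar> \<le> z\<^sup>2 / (2\<beta>) + \<beta> / 2\<close> in place of the Cauchy--Schwarz inequality.\<close>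
lemma (in prob_space) mixture_second_moment:
  fixes L :: "'i \<Rightarrow> 'a \<Rightarrow> real" and w :: "'i \<Rightarrow> real"
  assumes Q: "finite Q" and w: "\<And>q. q \<in> Q \<Longrightarrow> 0 \<le> w q" "sum w Q = 1"
    and int: "\<And>q. q \<in> Q \<Longrightarrow> integrable M (L q)"
    and int2: "\<And>q r. q \<in> Q \<Longrightarrow> r \<in> Q \<Longrightarrow> integrable M (\<lambda>x. L q x * L r x)"
    and one: "\<And>q. q \<in> Q \<Longrightarrow> expectation (L q) = 1"
    and sq: "(\<Sum>q\<in>Q. \<Sum>r\<in>Q. w q * w r * expectation (\<lambda>x. L q x * L r x)) \<le> 1 + \<beta>\<^sup>2"
    and \<beta>: "0 < \<beta>" and T: "T \<in> sets M"
  shows "1 - \<beta> \<le> prob T + (\<Sum>q\<in>Q. w q * expectation (\<lambda>x. L q x * indicator (space M - T) x))"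
proof -
  define Z where "Z x = (\<Sum>q\<in>Q. w q * L q x)" for x
  have Zi: "integrable M Z" unfolding Z_def using int by auto
  have Z1: "expectation Z = 1" unfolding Z_def using int one w(2) by simp
  have Zsq: "(Z x)\<^sup>2 = (\<Sum>q\<in>Q. \<Sum>r\<in>Q. w q * w r * (L q x * L r x))" for x
    unfolding Z_def power2_eq_square sum_product by (intro sum.cong refl) (simp add: algebra_simps)
  have Z2i: "integrable M (\<lambda>x. (Z x)\<^sup>2)" unfolding Zsq using int2 by auto
  have Z2: "expectation (\<lambda>x. (Z x)\<^sup>2) \<le> 1 + \<beta>\<^sup>2"
    unfolding Zsq using sq int2 by simp
  have ZT: "integrable M (\<lambda>x. Z x * indicator (space M - T) x)"
    using integrable_real_mult_indicator[OF _ Zi] T by simp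
  have I1: "integrable M (\<lambda>x. indicator (space M - T) x :: real)" using T by (auto simp: emeasure_eq_measure)
  \<comment> \<open>Off \<open>T\<close> this is \<open>Z >= 1 - \<bar>Z - 1\<bar>\<close> combined
    with the quadratic bound on \<open>\<bar>Z - 1\<bar>\<close>; on \<open>T\<close> it only says
    that this bound is nonnegative. The square is expanded so that only the first two moments of
    \<open>Z\<close> enter.\<close>
  have pw: "Z x * indicator (space M - T) x
      \<ge> indicator (space M - T) x - (((Z x)\<^sup>2 - 2 * Z x + 1) / (2*\<beta>) + \<beta>/2)" for x
  proof -
    have "0 \<le> (\<bar>Z x - 1\<bar> - \<beta>)\<^sup>2" by simp
    then have "2 * \<beta> * \<bar>Z x - 1\<bar> \<le> (Z x - 1)\<^sup>2 + \<beta>\<^sup>2"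
      by (simp add: power2_diff algebra_simps)
    then have "\<bar>Z x - 1\<bar> \<le> (Z x - 1)\<^sup>2 / (2*\<beta>) + \<beta>/2"
      using \<beta> by (simp add: field_simps power2_eq_square)
    moreover have "(Z x)\<^sup>2 - 2 * Z x + 1 = (Z x - 1)\<^sup>2" by (simp add: power2_diff)
    moreover have "0 \<le> (Z x - 1)\<^sup>2 / (2*\<beta>) + \<beta>/2" using \<beta> by simp
    ultimately show ?thesis by (cases "x \<in> space M - T") auto
  qed
  have "expectation (\<lambda>x. indicator (space M - T) x - (((Z x)\<^sup>2 - 2 * Z x + 1) / (2*\<beta>) + \<beta>/2))
      \<le> expectation (\<lambda>x. Z x * indicator (space M - T) x)"
    by (intro integral_mono pw Bochner_Integration.integrable_diff Bochner_Integration.integrable_add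
        I1 ZT integrable_divide integrable_mult_right Z2i Zi) auto
  moreover have "expectation (\<lambda>x. indicator (space M - T) x - (((Z x)\<^sup>2 - 2 * Z x + 1) / (2*\<beta>) + \<beta>/2))
     = prob (space M - T) - ((expectation (\<lambda>x. (Z x)\<^sup>2) - 2 + 1) / (2*\<beta>) + \<beta>/2)"
    using I1 Z2i Zi Z1 T by (simp add: prob_space)
  moreover have "(expectation (\<lambda>x. (Z x)\<^sup>2) - 2 + 1) / (2*\<beta>) \<le> \<beta>\<^sup>2 / (2*\<beta>)"
    using Z2 \<beta> by (intro divide_right_mono) auto
  moreover have "\<beta>\<^sup>2 / (2*\<beta>) = \<beta>/2" using \<beta> by (simp add: power2_eq_square)
  moreover have "prob (space M - T) = 1 - prob T" using T by (simp add: prob_compl)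
  moreover have "expectation (\<lambda>x. Z x * indicator (space M - T) x)
     = (\<Sum>q\<in>Q. w q * expectation (\<lambda>x. L q x * indicator (space M - T) x))"
  proof -
    have "integrable M (\<lambda>x. L q x * indicator (space M - T) x)" if "q \<in> Q" for q
      using integrable_real_mult_indicator[OF _ int[OF that]] T by simp
    then show ?thesis unfolding Z_def by (simp add: sum_distrib_right mult.assoc)
  qed
  ultimately show ?thesis by linarith
qed

text \<open>\<open>cosh\<close> is the moment generating function of a uniform sign, whose range has
  length 2. Hoeffding's estimate with parameters \<open>2*t\<close> and \<open>1/2\<close> bounds
  its logarithm for \<open>t >= 0\<close>; evenness gives the rest.\<close>

lemma cosh_le_exp_half_square: "cosh (t::real) \<le> exp (t\<^sup>2 / 2)"
proof -
  have *: "cosh t \<le> exp (t\<^sup>2 / 2)" if t: "t \<ge> 0" for t :: real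
  proof -
    have "1 + 1/2 * (exp (2*t) - 1) = exp t * cosh t"
      by (simp add: cosh_def field_simps flip: exp_add)
    moreover have "- (2*t) * (1/2) + ln (1 + 1/2 * (exp (2*t) - 1)) \<le> (2*t)\<^sup>2/8"
      using Hoeffdings_lemma_aux[of "2*t" "1/2"] t by simp
    ultimately have "ln (cosh t) \<le> t\<^sup>2/2"
      by (simp add: ln_mult power2_eq_square)
    then show ?thesis using cosh_real_pos[of t] by (metis exp_le_cancel_iff exp_ln)
  qed
  show ?thesis using *[of t] *[of "-t"] by (cases "t \<ge> 0") auto
qed

text \<open>The sum over sign vectors factorises over coordinates. A fixed sign
  \<open>\<sigma> j\<close> merely permutes the two values of \<open>\<epsilon> j\<close>, so each
  factor is \<open>2 * cosh (t j)\<close>.\<close>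

lemma sum_signs_exp_le:
  fixes t :: "'a \<Rightarrow> real"
  assumes J: "finite J" and \<sigma>: "\<And>j. j \<in> J \<Longrightarrow> \<sigma> j \<in> {-1, 1}"
  shows "(\<Sum>\<epsilon>\<in>(\<Pi>\<^sub>E j\<in>J. {-1, 1::real}). exp (\<Sum>j\<in>J. \<epsilon> j * \<sigma> j * t j))
    \<le> 2 ^ card J * exp ((\<Sum>j\<in>J. (t j)\<^sup>2) / 2)"
proof -
  have "(\<Sum>\<epsilon>\<in>(\<Pi>\<^sub>E j\<in>J. {-1, 1::real}). exp (\<Sum>j\<in>J. \<epsilon> j * \<sigma> j * t j))
      = (\<Sum>\<epsilon>\<in>(\<Pi>\<^sub>E j\<in>J. {-1, 1::real}). \<Prod>j\<in>J. exp (\<epsilon> j * \<sigma> j * t j))"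
    using J by (simp add: exp_sum)
  also have "\<dots> = (\<Prod>j\<in>J. \<Sum>e\<in>{-1, 1::real}. exp (e * \<sigma> j * t j))"
    using J by (subst prod_sum_PiE) auto
  also have "\<dots> = (\<Prod>j\<in>J. 2 * cosh (t j))"
  proof (rule prod.cong[OF refl])
    fix j assume "j \<in> J"
    with \<sigma> show "(\<Sum>e\<in>{-1, 1::real}. exp (e * \<sigma> j * t j)) = 2 * cosh (t j)"
      by (fastforce simp: cosh_def field_simps)
  qed
  also have "\<dots> \<le> (\<Prod>j\<in>J. 2 * exp ((t j)\<^sup>2 / 2))"
    by (intro prod_mono) (auto simp: cosh_le_exp_half_square)
  also have "\<dots> = 2 ^ card J * exp ((\<Sum>j\<in>J. (t j)\<^sup>2) / 2)"
    using J by (simp add: prod.distrib exp_sum sum_divide_distrib)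
  finally show ?thesis .
qed

text \<open>\<open>E\<close> stands for the logarithm of a bound on the cross moment of two
  likelihood ratios; \<open>w\<close> picks a block uniformly and then its signs uniformly. With
  \<open>N = card I\<close>, each pair of different blocks contributes \<open>1 / N^2\<close>.
  Averaging over signs bounds the contribution of a block paired with itself by
  \<open>D / N^2\<close>, and there are only \<open>N\<close> such pairs.\<close>

lemma sum_block_mixture_le:
  fixes t :: "'m \<Rightarrow> 'j \<Rightarrow> real" and E :: "'m \<times> ('j \<Rightarrow> real) \<Rightarrow> 'm \<times> ('j \<Rightarrow> real) \<Rightarrow> real"
  assumes I: "finite I" "I \<noteq> {}" and J: "\<And>m. m \<in> I \<Longrightarrow> finite (J m)"
    and off: "\<And>m m' \<epsilon> \<epsilon>'. m \<in> I \<Longrightarrow> m' \<in> I \<Longrightarrow> m \<noteq> m' \<Longrightarrow> E (m, \<epsilon>) (m', \<epsilon>') = 0"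
    and diag: "\<And>m \<epsilon> \<epsilon>'. m \<in> I \<Longrightarrow> E (m, \<epsilon>) (m, \<epsilon>') = (\<Sum>j\<in>J m. \<epsilon>' j * \<epsilon> j * t m j)"
    and D: "\<And>m. m \<in> I \<Longrightarrow> exp ((\<Sum>j\<in>J m. (t m j)\<^sup>2) / 2) \<le> D"
  defines "Q \<equiv> SIGMA m:I. \<Pi>\<^sub>E j\<in>J m. {-1, 1::real}"
    and "w \<equiv> \<lambda>q. 1 / (real (card I) * 2 ^ card (J (fst q)))"
  shows "sum w Q = 1"
    and "(\<Sum>q\<in>Q. \<Sum>q'\<in>Q. w q * w q' * exp (E q q')) \<le> 1 + D / real (card I)"
proof -
  define S where "S m = (\<Pi>\<^sub>E j\<in>J m. {-1, 1::real})" for m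
  define N where "N = real (card I)"
  have N: "N > 0" using I by (simp add: N_def card_gt_0_iff)
  have fS: "finite (S m)" if "m \<in> I" for m
    unfolding S_def using J[OF that] by (intro finite_PiE) auto
  have cS: "real (card (S m)) = 2 ^ card (J m)" if "m \<in> I" for m
    unfolding S_def using J[OF that] by (simp add: card_PiE)
  have Sig: "(\<Sum>q\<in>Q. h q) = (\<Sum>m\<in>I. \<Sum>\<epsilon>\<in>S m. h (m, \<epsilon>))" for h :: "_ \<Rightarrow> real"
    unfolding Q_def S_def[symmetric] using I fS by (subst sum.Sigma) auto
  show "sum w Q = 1"
  proof -
    have "sum w Q = (\<Sum>m\<in>I. 1 / N)"
      unfolding Sig by (intro sum.cong refl) (simp add: w_def N_def cS)
    then show ?thesis using N by (simp add: N_def)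
  qed
  \<comment> \<open>On the diagonal the summand \<open>1\<close> is slack: it lets the constant part
    run over all \<open>N^2\<close> pairs and add up to exactly \<open>1\<close>.\<close>
  have inner: "(\<Sum>\<epsilon>\<in>S m. \<Sum>\<epsilon>'\<in>S m'. w (m, \<epsilon>) * w (m', \<epsilon>') * exp (E (m, \<epsilon>) (m', \<epsilon>')))
      \<le> (1 + (if m = m' then D else 0)) / N\<^sup>2" if m: "m \<in> I" "m' \<in> I" for m m'
  proof (cases "m = m'")
    case True
    have D0: "D \<ge> 0" using D[OF m(1)] exp_ge_zero order_trans by blast
    have "(\<Sum>\<epsilon>'\<in>S m. exp (E (m, \<epsilon>) (m, \<epsilon>'))) \<le> 2 ^ card (J m) * D" if "\<epsilon> \<in> S m" for \<epsilon>
    proof -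
      have "(\<Sum>\<epsilon>'\<in>S m. exp (E (m, \<epsilon>) (m, \<epsilon>'))) \<le> 2 ^ card (J m) * exp ((\<Sum>j\<in>J m. (t m j)\<^sup>2) / 2)"
        unfolding diag[OF m(1)] S_def using that by (intro sum_signs_exp_le J m) (auto simp: S_def)
      also have "\<dots> \<le> 2 ^ card (J m) * D" using D[OF m(1)] by simp
      finally show ?thesis .
    qed
    then have "(\<Sum>\<epsilon>\<in>S m. \<Sum>\<epsilon>'\<in>S m. exp (E (m, \<epsilon>) (m, \<epsilon>'))) \<le> (\<Sum>\<epsilon>\<in>S m. 2 ^ card (J m) * D)"
      by (rule sum_mono)
    also have "\<dots> = (2 ^ card (J m))\<^sup>2 * D" by (simp add: cS m power2_eq_square)
    finally have *: "(\<Sum>\<epsilon>\<in>S m. \<Sum>\<epsilon>'\<in>S m. exp (E (m, \<epsilon>) (m, \<epsilon>'))) \<le> (2 ^ card (J m))\<^sup>2 * D" .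
    have "(\<Sum>\<epsilon>\<in>S m. \<Sum>\<epsilon>'\<in>S m. w (m, \<epsilon>) * w (m, \<epsilon>') * exp (E (m, \<epsilon>) (m, \<epsilon>')))
      = (\<Sum>\<epsilon>\<in>S m. \<Sum>\<epsilon>'\<in>S m. exp (E (m, \<epsilon>) (m, \<epsilon>'))) / (N\<^sup>2 * (2 ^ card (J m))\<^sup>2)"
      by (simp add: w_def N_def[symmetric] sum_divide_distrib power2_eq_square mult_ac)
    also have "\<dots> \<le> ((2 ^ card (J m))\<^sup>2 * D) / (N\<^sup>2 * (2 ^ card (J m))\<^sup>2)"
      by (intro divide_right_mono *) simp
    also have "\<dots> = D / N\<^sup>2" by (simp add: mult.commute)
    also have "\<dots> \<le> (1 + D) / N\<^sup>2" by (intro divide_right_mono) auto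
    finally show ?thesis using True by simp
  next
    case False
    then have "(\<Sum>\<epsilon>\<in>S m. \<Sum>\<epsilon>'\<in>S m'. w (m, \<epsilon>) * w (m', \<epsilon>') * exp (E (m, \<epsilon>) (m', \<epsilon>')))
      = (real (card (S m)) / 2 ^ card (J m)) * (real (card (S m')) / 2 ^ card (J m')) / N\<^sup>2"
      using m by (simp add: off w_def N_def[symmetric] power2_eq_square)
    then show ?thesis using False m by (simp add: cS)
  qed
  have "(\<Sum>q\<in>Q. \<Sum>q'\<in>Q. w q * w q' * exp (E q q'))
      = (\<Sum>m\<in>I. \<Sum>m'\<in>I. \<Sum>\<epsilon>\<in>S m. \<Sum>\<epsilon>'\<in>S m'. w (m, \<epsilon>) * w (m', \<epsilon>') * exp (E (m, \<epsilon>) (m', \<epsilon>')))"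
    unfolding Sig by (intro sum.cong refl) (rule sum.swap)
  also have "\<dots> \<le> (\<Sum>m\<in>I. \<Sum>m'\<in>I. (1 + (if m = m' then D else 0)) / N\<^sup>2)"
    by (intro sum_mono inner)
  also have "\<dots> = (N\<^sup>2 + N * D) / N\<^sup>2"
    using I by (simp add: sum_divide_distrib[symmetric] sum.distrib N_def power2_eq_square algebra_simps)
  also have "\<dots> = 1 + D / N" using N by (simp add: field_simps power2_eq_square)
  finally show "(\<Sum>q\<in>Q. \<Sum>q'\<in>Q. w q * w q' * exp (E q q')) \<le> 1 + D / real (card I)"
    by (simp add: N_def)
qed

subsection \<open>Trigonometric polynomials on the circle\<close>

lemma prob_space_U: "prob_space U"
  by (rule prob_spaceI) (simp add: emeasure_restrict_space)

lemma borel_measurable_U_continuous: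
  fixes f :: "real \<Rightarrow> 'b::{euclidean_space}"
  assumes "continuous_on UNIV f"
  shows "f \<in> borel_measurable U"
  using assms by (intro continuous_imp_measurable_on_sets_lebesgue continuous_on_subset[OF assms]) auto

lemma integrable_U_bounded_continuous:
  fixes f :: "real \<Rightarrow> 'b::{euclidean_space}"
  assumes "continuous_on UNIV f" "\<And>x. norm (f x) \<le> B"
  shows "integrable U f"
proof -
  interpret prob_space U by (rule prob_space_U)
  show ?thesis
    using assms by (intro integrable_const_bound[of _ B] borel_measurable_U_continuous) auto
qed

lemma integrable_U_cis: "integrable U (\<lambda>x. z * cis (a * x))"
  by (rule integrable_U_bounded_continuous[where B="norm z"])
     (auto intro!: continuous_intros simp: norm_mult)

lemma integral_U_cis:
  fixes m :: int
  shows "(LINT x|U. cis (2 * pi * real_of_int m * x)) = (if m = 0 then 1 else 0)"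
proof (cases "m = 0")
  case True
  interpret prob_space U by (rule prob_space_U)
  show ?thesis using True prob_space by (simp add: measure_restrict_space)
next
  case False
  define a where "a = 2 * pi * real_of_int m"
  have a: "a \<noteq> 0" using False by (simp add: a_def)
  have ca: "cis a = 1" unfolding a_def
    by (metis cis_multiple_2pi Ints_of_int mult.assoc)
  have "integrable U (\<lambda>x. cis (a * x))" using integrable_U_cis[of 1 a] by simp
  then have "(LINT x|U. cis (a * x)) = integral {0..<1} (\<lambda>x. cis (a * x))"
    by (rule lebesgue_integral_eq_integral) auto
  also have "\<dots> = integral {0..1} (\<lambda>x. cis (a * x))"
    by (rule integral_spike_set) (auto intro: negligible_subset[of "{1}"] )
  also have "\<dots> = 0"
  proof (rule integral_unique)
    have "((\<lambda>x. cis (a * x)) has_integral (cis (a * 1) / (\<i> * a) - cis (a * 0) / (\<i> * a))) {0..1}"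
    proof (rule fundamental_theorem_of_calculus)
      fix x :: real
      show "((\<lambda>x. cis (a * x) / (\<i> * a)) has_vector_derivative cis (a * x)) (at x within {0..1})"
        using a unfolding cis_conv_exp
        by (auto intro!: derivative_eq_intros has_vector_derivative_real_field[THEN has_vector_derivative_at_within] simp: field_simps)
    qed simp
    then show "((\<lambda>x. cis (a * x)) has_integral 0) {0..1}" using ca by simp
  qed
  finally show ?thesis using False by (simp add: a_def)
qed

text \<open>For \<open>J\<close> consisting of positive indices, this is the real function with
  Fourier coefficient \<open>c j\<close> at \<open>j\<close> and \<open>cnj (c j)\<close> at
  \<open>-j\<close>. The conjugate comes from the sign convention of \<open>fcoef\<close>, which
  integrates against \<open>cis (2 * pi * j * x)\<close>.\<close>

definition trig :: "nat set \<Rightarrow> (nat \<Rightarrow> complex) \<Rightarrow> real \<Rightarrow> real" where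
  "trig J c y = (\<Sum>j\<in>J. 2 * Re (cis (2 * pi * real j * y) * cnj (c j)))"

lemma continuous_trig: "continuous_on S (trig J c)"
  unfolding trig_def by (intro continuous_intros)

lemma abs_trig_le: "\<bar>trig J c y\<bar> \<le> 2 * (\<Sum>j\<in>J. cmod (c j))"
proof -
  have "\<bar>trig J c y\<bar> \<le> (\<Sum>j\<in>J. \<bar>2 * Re (cis (2 * pi * real j * y) * cnj (c j))\<bar>)"
    unfolding trig_def by (rule sum_abs)
  also have "\<dots> \<le> (\<Sum>j\<in>J. 2 * cmod (c j))"
  proof (rule sum_mono)
    fix j
    show "\<bar>2 * Re (cis (2 * pi * real j * y) * cnj (c j))\<bar> \<le> 2 * cmod (c j)"
      using abs_Re_le_cmod[of "cis (2 * pi * real j * y) * cnj (c j)"] by (simp add: norm_mult abs_mult)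
  qed
  finally show ?thesis by (simp add: sum_distrib_left)
qed

lemma integrable_trig_mult: "integrable U (\<lambda>y. trig J c y * trig K d y)"
  by (rule integrable_U_bounded_continuous[where B="(2 * (\<Sum>j\<in>J. cmod (c j))) * (2 * (\<Sum>j\<in>K. cmod (d j)))"])
     (auto intro!: continuous_intros continuous_trig mult_mono abs_trig_le mult_nonneg_nonneg sum_nonneg
       simp only: real_norm_def abs_mult norm_ge_zero abs_ge_zero zero_le_numeral)

lemma integrable_trig: "integrable U (trig J c)"
  by (rule integrable_U_bounded_continuous[OF continuous_trig, where B="2 * (\<Sum>j\<in>J. cmod (c j))"])
     (simp add: abs_trig_le)

lemma integral_U_Re_cis:
  "(LINT y|U. Re (cis (2 * pi * real_of_int m * y) * z)) = (if m = 0 then Re z else 0)"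
proof -
  have "integrable U (\<lambda>y. cis (2 * pi * real_of_int m * y) * z)"
    using integrable_U_cis[of z "2 * pi * real_of_int m"] by (simp add: mult.commute)
  then have "(LINT y|U. Re (cis (2 * pi * real_of_int m * y) * z))
    = Re (LINT y|U. cis (2 * pi * real_of_int m * y) * z)"
    by (rule integral_Re)
  also have "\<dots> = Re ((LINT y|U. cis (2 * pi * real_of_int m * y)) * z)"
    using integrable_U_cis[of 1 "2 * pi * real_of_int m"] by simp
  finally show ?thesis by (simp add: integral_U_cis)
qed

lemma integrable_U_Re_cis: "integrable U (\<lambda>y. Re (cis (a * y) * z))"
  using integrable_Re[OF integrable_U_cis[of z a]] by (simp add: mult.commute)

lemma integral_trig:
  assumes "finite J" "0 \<notin> J"
  shows "(LINT y|U. trig J c y) = 0"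
proof -
  have "(LINT y|U. trig J c y) = (\<Sum>j\<in>J. 2 * (LINT y|U. Re (cis (2 * pi * real j * y) * cnj (c j))))"
    unfolding trig_def
    by (subst Bochner_Integration.integral_sum)
       (simp_all only: integral_mult_right_zero integrable_mult_right integrable_U_Re_cis)
  also have "\<dots> = 0"
  proof (rule sum.neutral, rule ballI)
    fix j assume "j \<in> J"
    then have "j \<noteq> 0" using assms by (metis)
    then show "2 * (LINT y|U. Re (cis (2 * pi * real j * y) * cnj (c j))) = 0"
      using integral_U_Re_cis[of "int j" "cnj (c j)"] by simp
  qed
  finally show ?thesis .
qed

lemma Re_mult_Re: "2 * (Re a * Re b) = Re (a * b) + Re (a * cnj b)"
  by simp

text \<open>Product-to-sum formulas leave the frequencies \<open>j + k\<close> and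
  \<open>j - k\<close>. The first never vanishes for positive indices and the second only for
  \<open>j = k\<close>, so different frequencies are orthogonal.\<close>

lemma integral_trig_mult:
  assumes J: "finite J" "0 \<notin> J" and K: "finite K" "0 \<notin> K"
  shows "(LINT y|U. trig J c y * trig K d y) = (\<Sum>j\<in>J\<inter>K. 2 * Re (c j * cnj (d j)))"
proof -
  define P where "P j k y = 2 * Re (cis (2 * pi * real_of_int (int j + int k) * y) * (cnj (c j) * cnj (d k)))
     + 2 * Re (cis (2 * pi * real_of_int (int j - int k) * y) * (cnj (c j) * d k))" for j k y
  have "2 * Re (cis (2 * pi * real j * y) * cnj (c j)) * (2 * Re (cis (2 * pi * real k * y) * cnj (d k))) = P j k y" for j k y
  proof -
    have "2 * Re (cis (2 * pi * real j * y) * cnj (c j)) * (2 * Re (cis (2 * pi * real k * y) * cnj (d k)))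
      = 2 * (Re ((cis (2 * pi * real j * y) * cnj (c j)) * (cis (2 * pi * real k * y) * cnj (d k)))
         + Re ((cis (2 * pi * real j * y) * cnj (c j)) * cnj (cis (2 * pi * real k * y) * cnj (d k))))"
      by (subst Re_mult_Re[symmetric]) (simp del: times_complex.sel)
    also have "(cis (2 * pi * real j * y) * cnj (c j)) * (cis (2 * pi * real k * y) * cnj (d k))
      = (cis (2 * pi * real j * y) * cis (2 * pi * real k * y)) * (cnj (c j) * cnj (d k))"
      by (simp only: ac_simps)
    also have "\<dots> = cis (2 * pi * real_of_int (int j + int k) * y) * (cnj (c j) * cnj (d k))"
      by (simp add: cis_mult algebra_simps)
    also have "(cis (2 * pi * real j * y) * cnj (c j)) * cnj (cis (2 * pi * real k * y) * cnj (d k))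
      = (cis (2 * pi * real j * y) * cis (- (2 * pi * real k * y))) * (cnj (c j) * d k)"
      by (simp add: cis_cnj)
    also have "\<dots> = cis (2 * pi * real_of_int (int j - int k) * y) * (cnj (c j) * d k)"
      by (simp add: cis_mult algebra_simps)
    finally show ?thesis unfolding P_def by (simp only: distrib_left)
  qed
  then have e: "trig J c y * trig K d y = (\<Sum>j\<in>J. \<Sum>k\<in>K. P j k y)" for y
    unfolding trig_def sum_product by simp
  have Pi: "integrable U (P j k)" for j k
    unfolding P_def by (intro Bochner_Integration.integrable_add integrable_mult_right integrable_U_Re_cis)
  have PI: "(LINT y|U. P j k y) = (if j = k then 2 * Re (c j * cnj (d j)) else 0)" if "j \<in> J" "k \<in> K" for j k
  proof -
    have "int j + int k \<noteq> 0" using that J by (cases "j = 0") auto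
    then have "(LINT y|U. P j k y) = (if int j - int k = 0 then 2 * Re (cnj (c j) * d k) else 0)"
      unfolding P_def
      by (subst Bochner_Integration.integral_add)
         (simp_all only: integral_mult_right_zero integrable_mult_right integrable_U_Re_cis
           integral_U_Re_cis if_False mult_zero_right add_0_left if_distrib[of "(*) 2"])
    then show ?thesis by auto
  qed
  have "(LINT y|U. trig J c y * trig K d y) = (\<Sum>j\<in>J. \<Sum>k\<in>K. LINT y|U. P j k y)"
    unfolding e using Pi by simp
  also have "\<dots> = (\<Sum>j\<in>J. \<Sum>k\<in>K. if j = k then 2 * Re (c j * cnj (d j)) else 0)"
    by (intro sum.cong refl PI)
  also have "\<dots> = (\<Sum>j\<in>J\<inter>K. 2 * Re (c j * cnj (d j)))"
    using J K by (simp add: sum.inter_restrict del: times_complex.sel)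
  finally show ?thesis .
qed

text \<open>Multiplying by the character of frequency \<open>l\<close> produces the frequencies
  \<open>l + j\<close> and \<open>l - j\<close>; as \<open>0 < l\<close>, only \<open>j = l\<close>
  survives integration.\<close>

lemma fcoef_trig:
  assumes J: "finite J" "0 \<notin> J" and l: "0 < l"
  shows "fcoef (trig J c) (int l) = (if l \<in> J then c l else 0)"
proof -
  define P where "P j x = cnj (c j) * cis (2 * pi * real_of_int (int l + int j) * x)
      + c j * cis (2 * pi * real_of_int (int l - int j) * x)" for j x
  have "complex_of_real (2 * Re (cis (2 * pi * real j * x) * cnj (c j))) * cis (2 * pi * real_of_int (int l) * x) = P j x" for j x
  proof -
    have "complex_of_real (2 * Re (cis (2 * pi * real j * x) * cnj (c j)))
      = cis (2 * pi * real j * x) * cnj (c j) + cnj (cis (2 * pi * real j * x) * cnj (c j))"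
      by (subst complex_add_cnj) simp
    also have "\<dots> * cis (2 * pi * real_of_int (int l) * x)
      = cnj (c j) * (cis (2 * pi * real j * x) * cis (2 * pi * real_of_int (int l) * x))
       + c j * (cis (- (2 * pi * real j * x)) * cis (2 * pi * real_of_int (int l) * x))"
      by (simp add: cis_cnj algebra_simps)
    also have "\<dots> = P j x" unfolding P_def by (simp add: cis_mult algebra_simps)
    finally show ?thesis .
  qed
  then have e: "complex_of_real (trig J c x) * cis (2 * pi * real_of_int (int l) * x) = (\<Sum>j\<in>J. P j x)" for x
    unfolding trig_def of_real_sum sum_distrib_right by simp
  have Pi: "integrable U (P j)" for j
    unfolding P_def by (intro Bochner_Integration.integrable_add integrable_U_cis)
  have ic: "integrable U (\<lambda>x. cis (a * x))" for a using integrable_U_cis[of 1] by simp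
  have PI: "(LINT y|U. P j y) = (if l = j then c j else 0)" for j
  proof -
    have "int l + int j \<noteq> 0" using l by auto
    then have "(LINT y|U. P j y) = (if int l - int j = 0 then c j else 0)"
      unfolding P_def
      by (subst Bochner_Integration.integral_add)
         (auto intro!: integrable_U_cis ic simp: integral_U_cis simp del: of_int_add of_int_diff)
    then show ?thesis by auto
  qed
  have "fcoef (trig J c) (int l) = (\<Sum>j\<in>J. LINT y|U. P j y)"
    unfolding fcoef_def e using Pi by simp
  also have "\<dots> = (if l \<in> J then c l else 0)"
    unfolding PI using J by (simp add: sum.delta)
  finally show ?thesis .
qed

lemma cis_frac: "cis (2 * pi * real j * (t - of_int \<lfloor>t\<rfloor>)) = cis (2 * pi * real j * t)"
proof -
  have "cis (2 * pi * real j * (t - of_int \<lfloor>t\<rfloor>)) = cis (2 * pi * real j * t) / cis (2 * pi * of_int (int j * \<lfloor>t\<rfloor>))"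
    by (simp add: cis_divide algebra_simps)
  also have "cis (2 * pi * of_int (int j * \<lfloor>t\<rfloor>)) = 1" by (metis cis_multiple_2pi Ints_of_int)
  finally show ?thesis by simp
qed

text \<open>Convolution acts diagonally on Fourier modes, and the constant part stays
  \<open>1\<close> because \<open>\<phi>\<close> has integral one. Reduction modulo 1 is invisible
  to integer frequencies (\<open>cis_frac\<close>) and brings every point into the interval where
  \<open>f_null\<close> equals one.\<close>

lemma circ_conv_trig:
  assumes J: "finite J" and \<phi>: "integrable U \<phi>" "(LINT x|U. \<phi> x) = 1"
  shows "circ_conv (\<lambda>x. f_null x + trig J c x) \<phi> y = 1 + trig J (\<lambda>j. c j * fcoef \<phi> (int j)) y"
proof -
  define F where "F j s = complex_of_real (\<phi> s) * cis (2 * pi * real_of_int (int j) * s)" for j s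
  have Fi: "integrable U (F j)" for j
  proof (rule Bochner_Integration.integrable_bound[of _ \<phi>])
    show "F j \<in> borel_measurable U" unfolding F_def
      using borel_measurable_integrable[OF \<phi>(1)]
      by (intro borel_measurable_times measurable_compose[OF _ borel_measurable_of_real]
          borel_measurable_U_continuous[of "\<lambda>x. cis (a * x)" for a]) (auto intro!: continuous_intros)
  qed (use \<phi> in \<open>auto simp: F_def norm_mult\<close>)
  have fn: "f_null (t - of_int \<lfloor>t\<rfloor>) = 1" for t :: real
    unfolding f_null_def by (auto simp: indicator_def) linarith+
  have Fs: "2 * Re (cis (2 * pi * real j * (y - s)) * cnj (c j)) * \<phi> s
      = 2 * Re ((cis (2 * pi * real j * y) * cnj (c j)) * cnj (F j s))" for j s
  proof -
    have "cis (2 * pi * real j * (y - s)) = cis (2 * pi * real j * y) * cnj (cis (2 * pi * real j * s))"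
      by (simp add: cis_cnj cis_mult algebra_simps)
    then have "(cis (2 * pi * real j * y) * cnj (c j)) * cnj (F j s)
       = complex_of_real (\<phi> s) * (cis (2 * pi * real j * (y - s)) * cnj (c j))"
      unfolding F_def by simp
    moreover have "Re (complex_of_real a * z) = a * Re z" for a z by simp
    ultimately show ?thesis by (simp only: mult.assoc mult.commute[of "\<phi> s"])
  qed
  have cFi: "integrable U (\<lambda>s. (cis (2 * pi * real j * y) * cnj (c j)) * cnj (F j s))" for j
    using Fi by (intro integrable_mult_right) simp
  have "circ_conv (\<lambda>x. f_null x + trig J c x) \<phi> y
      = (LINT s|U. \<phi> s + (\<Sum>j\<in>J. 2 * Re ((cis (2 * pi * real j * y) * cnj (c j)) * cnj (F j s))))"
    unfolding circ_conv_def fn trig_def cis_frac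
    by (simp only: distrib_right sum_distrib_right Fs mult_1)
  also have "\<dots> = 1 + (\<Sum>j\<in>J. 2 * (LINT s|U. Re ((cis (2 * pi * real j * y) * cnj (c j)) * cnj (F j s))))"
  proof -
    have "integrable U (\<lambda>s. Re ((cis (2 * pi * real j * y) * cnj (c j)) * cnj (F j s)))" for j
      by (rule integrable_Re[OF cFi])
    then show ?thesis
      using \<phi> by (simp del: times_complex.sel)
  qed
  also have "\<dots> = 1 + (\<Sum>j\<in>J. 2 * Re (cis (2 * pi * real j * y) * cnj (c j * fcoef \<phi> (int j))))"
  proof -
    have "(LINT s|U. Re ((cis (2 * pi * real j * y) * cnj (c j)) * cnj (F j s)))
      = Re (cis (2 * pi * real j * y) * cnj (c j * fcoef \<phi> (int j)))" for j
    proof -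
      have "(LINT s|U. Re ((cis (2 * pi * real j * y) * cnj (c j)) * cnj (F j s)))
        = Re (LINT s|U. (cis (2 * pi * real j * y) * cnj (c j)) * cnj (F j s))"
        by (rule integral_Re[OF cFi])
      also have "(LINT s|U. (cis (2 * pi * real j * y) * cnj (c j)) * cnj (F j s))
        = (cis (2 * pi * real j * y) * cnj (c j)) * cnj (fcoef \<phi> (int j))"
        by (simp only: integral_mult_right_zero Bochner_Integration.integral_cnj) (simp only: fcoef_def F_def)
      finally show ?thesis by (simp add: mult.assoc)
    qed
    then show ?thesis by presburger
  qed
  finally show ?thesis unfolding trig_def .
qed

lemma cmod_fcoef_dens_le_1:
  assumes "\<phi> \<in> dens_set" shows "cmod (fcoef \<phi> j) \<le> 1"
proof -
  have "cmod (fcoef \<phi> j) \<le> (LINT x|U. norm (complex_of_real (\<phi> x) * cis (2 * pi * real_of_int j * x)))"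
    unfolding fcoef_def by (rule integral_norm_bound)
  also have "\<dots> = (LINT x|U. \<phi> x)"
    using assms by (intro Bochner_Integration.integral_cong) (auto simp: dens_set_def norm_mult space_restrict_space)
  finally show ?thesis using assms by (simp add: dens_set_def)
qed

lemma fcoef_minus: "fcoef \<phi> (- j) = cnj (fcoef \<phi> j)"
  unfolding fcoef_def by (simp add: cis_cnj flip: Bochner_Integration.integral_cnj)

lemma circ_conv_null:
  assumes "(LINT x|U. \<phi> x) = 1"
  shows "circ_conv f_null \<phi> y = 1"
proof -
  have "f_null (t - of_int \<lfloor>t\<rfloor>) = 1" for t :: real
    unfolding f_null_def by (auto simp: indicator_def) linarith+
  then show ?thesis using assms by (simp add: circ_conv_def)
qed

subsection \<open>Risk lower bound by a finite mixture\<close>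

text \<open>The coefficient bound keeps \<open>trig J b\<close> between \<open>-1\<close> and
  \<open>1\<close>, which gives nonnegativity and integrability; since frequency zero is absent, the
  perturbation has mean zero and the total mass stays one.\<close>

lemma dens_set_trig:
  assumes J: "finite J" "0 \<notin> J" and b: "2 * (\<Sum>j\<in>J. cmod (b j)) \<le> 1"
  shows "(\<lambda>x. f_null x + trig J b x) \<in> dens_set"
proof -
  interpret prob_space U by (rule prob_space_U)
  have bd: "\<bar>trig J b x\<bar> \<le> 1" for x using abs_trig_le[where J=J and c=b and y=x] b by linarith
  define f where "f = (\<lambda>x. f_null x + trig J b x)"
  have fU: "f x = 1 + trig J b x" if "x \<in> space U" for x
    using that by (simp add: f_def f_null_def)
  have cont: "continuous_on UNIV (\<lambda>x. 1 + trig J b x)"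
    by (intro continuous_intros continuous_trig)
  have m: "f \<in> borel_measurable U"
    using borel_measurable_U_continuous[OF cont] by (subst measurable_cong[OF fU])
  have i: "integrable U f"
  proof (rule integrable_const_bound[where B=2])
    show "AE x in U. norm (f x) \<le> 2"
    proof (rule AE_I2)
      fix x assume "x \<in> space U"
      then show "norm (f x) \<le> 2" using bd[of x] by (simp add: fU)
    qed
  qed (rule m)
  have "integrable U (\<lambda>x. (f x)\<^sup>2)"
  proof (rule integrable_const_bound[where B=4])
    show "AE x in U. norm ((f x)\<^sup>2) \<le> 4"
    proof (rule AE_I2)
      fix x assume "x \<in> space U"
      then have "\<bar>f x\<bar> \<le> 2" using bd[of x] by (simp add: fU)
      then have "\<bar>f x\<bar>\<^sup>2 \<le> 2\<^sup>2" by (intro power_mono) auto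
      then show "norm ((f x)\<^sup>2) \<le> 4" by simp
    qed
  qed (use m in measurable)
  moreover have "(LINT x|U. f x) = (LINT x|U. 1 + trig J b x)"
    using fU by (rule Bochner_Integration.integral_cong[OF refl])
  then have "(LINT x|U. f x) = 1"
    using J by (simp add: integrable_trig integral_trig prob_space[simplified])
  moreover have "0 \<le> f x" if "x \<in> {0..<1}" for x
    using fU[of x] bd[of x] that by auto
  ultimately show ?thesis using m i by (auto simp: dens_set_def f_def[symmetric])
qed

lemma L2norm_trig:
  assumes J: "finite J" "0 \<notin> J"
  shows "L2norm (trig J b) = sqrt (2 * (\<Sum>j\<in>J. (cmod (b j))\<^sup>2))"
  using integral_trig_mult[OF J J, of b b]
  by (simp add: L2norm_def power2_eq_square sum_distrib_left cmod_def flip: power2_eq_square)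

lemma trig_in_ellipsoid:
  assumes J: "finite J" "0 \<notin> J" and b: "2 * (\<Sum>j\<in>J. (cmod (b j))\<^sup>2 / (a j)\<^sup>2) \<le> R\<^sup>2"
  shows "trig J b \<in> ellipsoid a R"
proof -
  define g where "g j = (if j \<in> J then (cmod (b j))\<^sup>2 / (a j)\<^sup>2 else 0)" for j
  \<comment> \<open>\<open>ellipsoid\<close> enumerates the positive frequencies as
    \<open>Suc j\<close> from \<open>j = 0\<close>. As \<open>0 \<notin> J\<close>,
    \<open>Suc\<close> maps the pulled-back set onto \<open>J\<close>, which turns the series into a
    finite sum over \<open>J\<close>.\<close>
  have s: "bij_betw Suc (Suc -` J) J"
    using J by (auto simp: bij_betw_def inj_on_def image_iff) (metis not0_implies_Suc)
  have fin: "finite (Suc -` J)" using bij_betw_finite[OF s] J by simp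
  have "(\<Sum>j. ennreal ((cmod (fcoef (trig J b) (int (Suc j))))\<^sup>2 / (a (Suc j))\<^sup>2)) = (\<Sum>j. ennreal (g (Suc j)))"
    using J by (intro suminf_cong) (auto simp: fcoef_trig g_def simp del: of_nat_Suc)
  also have "\<dots> = (\<Sum>j\<in>Suc -` J. ennreal (g (Suc j)))"
    using fin by (intro suminf_finite) (auto simp: g_def)
  also have "\<dots> = (\<Sum>j\<in>J. ennreal (g j))" by (rule sum.reindex_bij_betw[OF s])
  also have "\<dots> = ennreal (\<Sum>j\<in>J. g j)" by (rule sum_ennreal) (simp add: g_def)
  also have "2 * \<dots> = ennreal (2 * (\<Sum>j\<in>J. g j))"
    by (simp add: ennreal_mult' sum_nonneg g_def)
  also have "\<dots> \<le> ennreal (R\<^sup>2)" using b by (intro ennreal_leI) (simp add: g_def)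
  finally show ?thesis by (simp add: ellipsoid_def)
qed

text \<open>Since \<open>cmod (fcoef \<phi> j) <= 1\<close>, convolution does not increase the
  coefficients, so the density of one observation is again nonnegative and its product may be formed
  over the reals.\<close>

lemma joint_law_trig:
  assumes \<phi>: "\<phi> \<in> dens_set" and J: "finite J" "0 \<notin> J" and b: "2 * (\<Sum>j\<in>J. cmod (b j)) \<le> 1"
  shows "joint_law n \<phi> (\<lambda>x. f_null x + trig J b x)
    = density (PiM {..<n} (\<lambda>_. U)) (\<lambda>\<omega>. ennreal (\<Prod>i<n. 1 + trig J (\<lambda>j. b j * fcoef \<phi> (int j)) (\<omega> i)))"
proof -
  let ?g = "trig J (\<lambda>j. b j * fcoef \<phi> (int j))"
  interpret prob_space U by (rule prob_space_U)
  have "(\<Sum>j\<in>J. cmod (b j * fcoef \<phi> (int j))) \<le> (\<Sum>j\<in>J. cmod (b j))"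
    using \<phi> by (intro sum_mono) (auto simp: norm_mult cmod_fcoef_dens_le_1 intro: mult_left_le)
  then have bd: "\<bar>?g y\<bar> \<le> 1" for y
    using abs_trig_le[where J=J and c="\<lambda>j. b j * fcoef \<phi> (int j)" and y=y] b by linarith
  have pos: "0 \<le> 1 + ?g y" for y using bd[of y] by linarith
  have m[measurable]: "(\<lambda>y. 1 + ?g y) \<in> borel_measurable U"
    by (intro borel_measurable_U_continuous continuous_intros continuous_trig)
  have i: "integrable U (\<lambda>y. 1 + ?g y)" using integrable_trig by simp
  \<comment> \<open>\<open>PiM_density\<close> asks for a sigma-finite one-dimensional law; its
    total mass is finite.\<close>
  have "emeasure (density U (\<lambda>y. ennreal (1 + ?g y))) (space U) = (\<integral>\<^sup>+y. ennreal (1 + ?g y) \<partial>U)"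
    by (simp add: emeasure_density) (intro nn_integral_cong, simp)
  also have "\<dots> = ennreal (LINT y|U. 1 + ?g y)"
    using i pos by (intro nn_integral_eq_integral) auto
  finally have "finite_measure (density U (\<lambda>y. ennreal (1 + ?g y)))"
    by (intro finite_measureI) simp
  then have sf: "sigma_finite_measure (density U (\<lambda>y. ennreal (1 + ?g y)))"
    by (simp add: finite_measure_def)
  have "joint_law n \<phi> (\<lambda>x. f_null x + trig J b x) = PiM {..<n} (\<lambda>_. density U (\<lambda>y. ennreal (1 + ?g y)))"
    using \<phi> J by (simp add: joint_law_def obs_law_def circ_conv_trig dens_set_def)
  also have "\<dots> = density (PiM {..<n} (\<lambda>_. U)) (\<lambda>\<omega>. \<Prod>i<n. ennreal (1 + ?g (\<omega> i)))"
    by (rule PiM_density) (auto simp: sf sigma_finite_measure_axioms)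
  finally show ?thesis using pos by (simp add: prod_ennreal)
qed

lemma joint_law_null:
  assumes "\<phi> \<in> dens_set"
  shows "joint_law n \<phi> f_null = PiM {..<n} (\<lambda>_. U)"
  using assms by (simp add: joint_law_def obs_law_def circ_conv_null dens_set_def density_1)

text \<open>For any test the sum of both error probabilities, averaged over the prior
  \<open>w\<close>, is at least \<open>1 - \<beta>\<close> by \<open>mixture_second_moment\<close>,
  so some single alternative \<open>q\<close> reaches this value. The exponential sum controls the
  second moment because each cross moment of likelihood ratios has the form
  \<open>(1 + u)^n\<close>, which is at most \<open>exp (n * u)\<close>.\<close>

lemma SUP_risk_ge_mixture:
  fixes b :: "'i \<Rightarrow> nat \<Rightarrow> complex"
  assumes \<phi>: "\<phi> \<in> dens_set" and \<Delta>: "\<Delta> \<in> tests n"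
    and Q: "finite Q" and w: "\<And>q. q \<in> Q \<Longrightarrow> 0 \<le> w q" "sum w Q = 1"
    and J: "\<And>q. q \<in> Q \<Longrightarrow> finite (J q)" "\<And>q. q \<in> Q \<Longrightarrow> 0 \<notin> J q"
    and b: "\<And>q. q \<in> Q \<Longrightarrow> 2 * (\<Sum>j\<in>J q. cmod (b q j)) \<le> 1"
    and a: "\<And>q. q \<in> Q \<Longrightarrow> a q \<in> \<A>"
    and ell: "\<And>q. q \<in> Q \<Longrightarrow> 2 * (\<Sum>j\<in>J q. (cmod (b q j))\<^sup>2 / (a q j)\<^sup>2) \<le> R\<^sup>2"
    and sep: "\<And>q. q \<in> Q \<Longrightarrow> r (a q) \<le> sqrt (2 * (\<Sum>j\<in>J q. (cmod (b q j))\<^sup>2))"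
    and sq: "(\<Sum>q\<in>Q. \<Sum>q'\<in>Q. w q * w q' * exp (real n *
        (\<Sum>j\<in>J q \<inter> J q'. 2 * Re (b q j * cnj (b q' j)) * (cmod (fcoef \<phi> (int j)))\<^sup>2))) \<le> 1 + \<beta>\<^sup>2"
    and \<beta>: "0 < \<beta>"
  shows "ennreal (1 - \<beta>) \<le> (SUP a\<in>\<A>. risk n \<phi> \<Delta> a R (r a))"
proof -
  let ?P = "PiM {..<n} (\<lambda>_. U)"
  interpret U: prob_space U by (rule prob_space_U)
  interpret PU: product_prob_space "\<lambda>_::nat. U" by unfold_locales
  interpret P: prob_space ?P by (rule prob_space_PiM) (rule prob_space_U)
  define c where "c q j = b q j * fcoef \<phi> (int j)" for q j
  define g where "g q y = 1 + trig (J q) (c q) y" for q y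
  define L where "L q \<omega> = (\<Prod>i<n. g q (\<omega> i))" for q and \<omega> :: "nat \<Rightarrow> real"
  define T where "T = {\<omega> \<in> space ?P. \<Delta> \<omega>}"
  have T: "T \<in> sets ?P" using \<Delta> unfolding T_def tests_def by (auto intro: predE)
  have gpos: "0 \<le> g q y" if "q \<in> Q" for q y
  proof -
    have "(\<Sum>j\<in>J q. cmod (c q j)) \<le> (\<Sum>j\<in>J q. cmod (b q j))"
      unfolding c_def using \<phi> by (intro sum_mono) (auto simp: norm_mult cmod_fcoef_dens_le_1 intro: mult_left_le)
    then show ?thesis
      using abs_trig_le[where J="J q" and c="c q" and y=y] b[OF that] by (auto simp: g_def abs_le_iff)
  qed
  have gi: "integrable U (g q)" for q unfolding g_def using integrable_trig by simp
  have g1: "(LINT y|U. g q y) = 1" if "q \<in> Q" for q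
    unfolding g_def using J[OF that] U.prob_space by (simp add: integrable_trig integral_trig)
  have gge: "g q y * g q' y = 1 + trig (J q) (c q) y + trig (J q') (c q') y + trig (J q) (c q) y * trig (J q') (c q') y"
    for q q' y unfolding g_def by (simp add: algebra_simps)
  have ggi: "integrable U (\<lambda>y. g q y * g q' y)" for q q'
    unfolding gge by (intro Bochner_Integration.integrable_add integrable_trig integrable_trig_mult) simp
  \<comment> \<open>Each convolved coefficient carries a factor \<open>fcoef \<phi> (int j)\<close>;
    in the product with a conjugate only its squared modulus remains.\<close>
  have Re_c: "2 * Re (c q j * cnj (c q' j)) = 2 * Re (b q j * cnj (b q' j)) * (cmod (fcoef \<phi> (int j)))\<^sup>2" for q q' j
  proof -
    have "c q j * cnj (c q' j) = (b q j * cnj (b q' j)) * (fcoef \<phi> (int j) * cnj (fcoef \<phi> (int j)))"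
      unfolding c_def by simp
    also have "\<dots> = (b q j * cnj (b q' j)) * complex_of_real ((cmod (fcoef \<phi> (int j)))\<^sup>2)"
      by (simp add: complex_norm_square[symmetric])
    finally show ?thesis by simp
  qed
  define u where "u q q' = (\<Sum>j\<in>J q \<inter> J q'. 2 * Re (b q j * cnj (b q' j)) * (cmod (fcoef \<phi> (int j)))\<^sup>2)" for q q'
  have gg1: "(LINT y|U. g q y * g q' y) = 1 + u q q'" if "q \<in> Q" "q' \<in> Q" for q q'
  proof -
    have "(LINT y|U. g q y * g q' y) = (LINT y|U. 1) + (LINT y|U. trig (J q) (c q) y)
        + (LINT y|U. trig (J q') (c q') y) + (LINT y|U. trig (J q) (c q) y * trig (J q') (c q') y)"
      unfolding gge by (simp add: integrable_trig integrable_trig_mult)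
    also have "\<dots> = 1 + u q q'"
      using J[OF that(1)] J[OF that(2)] U.prob_space Re_c unfolding u_def
      by (simp add: integral_trig integral_trig_mult mult.assoc del: times_complex.sel)
    finally show ?thesis .
  qed
  have Li: "integrable ?P (L q)" for q
    unfolding L_def by (rule PU.product_integrable_prod) (auto intro: gi)
  have L1: "P.expectation (L q) = 1" if "q \<in> Q" for q
    unfolding L_def using that by (subst PU.product_integral_prod) (auto intro: gi simp: g1)
  have LL: "L q \<omega> * L q' \<omega> = (\<Prod>i<n. g q (\<omega> i) * g q' (\<omega> i))" for q q' \<omega>
    unfolding L_def by (simp add: prod.distrib)
  have LLi: "integrable ?P (\<lambda>\<omega>. L q \<omega> * L q' \<omega>)" for q q'
    unfolding LL by (rule PU.product_integrable_prod) (auto intro: ggi)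
  have LL1: "P.expectation (\<lambda>\<omega>. L q \<omega> * L q' \<omega>) \<le> exp (real n * u q q')" if "q \<in> Q" "q' \<in> Q" for q q'
  proof -
    have "P.expectation (\<lambda>\<omega>. L q \<omega> * L q' \<omega>) = (1 + u q q') ^ n"
      unfolding LL using that by (subst PU.product_integral_prod) (auto intro: ggi simp: gg1)
    also have "\<dots> \<le> exp (u q q') ^ n"
    proof (rule power_mono[OF exp_ge_add_one_self])
      \<comment> \<open>Monotonicity of the power needs a nonnegative base; it is one as the
        integral of a product of two densities.\<close>
      show "0 \<le> 1 + u q q'"
        unfolding gg1[OF that, symmetric] using gpos that by (intro Bochner_Integration.integral_nonneg) auto
    qed
    finally show ?thesis by (simp add: exp_of_nat_mult)
  qed
  \<comment> \<open>Sum of the two error probabilities against the single alternative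
    \<open>q\<close>, the second one written under the null law through the likelihood
    ratio.\<close>
  define v where "v q = P.prob T + P.expectation (\<lambda>\<omega>. L q \<omega> * indicator (space ?P - T) \<omega>)" for q
  have "1 - \<beta> \<le> P.prob T + (\<Sum>q\<in>Q. w q * P.expectation (\<lambda>\<omega>. L q \<omega> * indicator (space ?P - T) \<omega>))"
  proof (rule P.mixture_second_moment[OF Q w Li LLi L1 _ \<beta> T])
    have "(\<Sum>q\<in>Q. \<Sum>q'\<in>Q. w q * w q' * P.expectation (\<lambda>\<omega>. L q \<omega> * L q' \<omega>))
      \<le> (\<Sum>q\<in>Q. \<Sum>q'\<in>Q. w q * w q' * exp (real n * u q q'))"
      by (intro sum_mono mult_left_mono LL1 mult_nonneg_nonneg w)
    with sq show "(\<Sum>q\<in>Q. \<Sum>q'\<in>Q. w q * w q' * P.expectation (\<lambda>\<omega>. L q \<omega> * L q' \<omega>)) \<le> 1 + \<beta>\<^sup>2"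
      by (simp only: u_def)
  qed
  also have "\<dots> = (\<Sum>q\<in>Q. w q * v q)"
    using w(2) unfolding v_def by (simp add: distrib_left sum.distrib sum_distrib_right[symmetric])
  finally have sum_v: "1 - \<beta> \<le> (\<Sum>q\<in>Q. w q * v q)" .
  have "\<exists>q\<in>Q. 1 - \<beta> \<le> v q"
  proof (rule ccontr)
    assume "\<not> ?thesis"
    then have less: "\<And>q. q \<in> Q \<Longrightarrow> v q < 1 - \<beta>" by force
    \<comment> \<open>Strict inequality of the averages needs an index of positive weight; it exists
      because the weights sum to one.\<close>
    obtain q0 where q0: "q0 \<in> Q" "w q0 > 0"
      using w Q sum_nonpos[of Q w] by (metis less_eq_real_def linorder_not_le zero_less_one)
    have "(\<Sum>q\<in>Q. w q * v q) < (\<Sum>q\<in>Q. w q * (1 - \<beta>))"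
      using Q w less q0 by (intro sum_strict_mono_ex1) (auto intro!: mult_left_mono bexI[of _ q0] simp: less_imp_le)
    also have "\<dots> = 1 - \<beta>" using w(2) by (simp add: sum_distrib_right[symmetric])
    finally show False using sum_v by simp
  qed
  then obtain q where q: "q \<in> Q" "1 - \<beta> \<le> v q" by blast
  let ?f = "\<lambda>x. f_null x + trig (J q) (b q) x"
  have law: "joint_law n \<phi> ?f = density ?P (\<lambda>\<omega>. ennreal (L q \<omega>))"
    using joint_law_trig[OF \<phi> J(1)[OF q(1)] J(2)[OF q(1)] b[OF q(1)]] unfolding L_def g_def c_def .
  have Lpos: "0 \<le> L q \<omega>" for \<omega> unfolding L_def using gpos[OF q(1)] by (intro prod_nonneg) auto
  have comp: "{\<omega> \<in> space (joint_law n \<phi> ?f). \<not> \<Delta> \<omega>} = space ?P - T"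
    unfolding law T_def by auto
  have "emeasure (joint_law n \<phi> ?f) {\<omega> \<in> space (joint_law n \<phi> ?f). \<not> \<Delta> \<omega>}
      = (\<integral>\<^sup>+\<omega>. ennreal (L q \<omega> * indicator (space ?P - T) \<omega>) \<partial>?P)"
    unfolding comp unfolding law using T Li[of q]
    by (subst emeasure_density) (auto intro!: nn_integral_cong simp: indicator_def)
  also have "\<dots> = ennreal (P.expectation (\<lambda>\<omega>. L q \<omega> * indicator (space ?P - T) \<omega>))"
    using integrable_real_mult_indicator[OF _ Li[of q]] T Lpos by (intro nn_integral_eq_integral) auto
  finally have em: "emeasure (joint_law n \<phi> ?f) {\<omega> \<in> space (joint_law n \<phi> ?f). \<not> \<Delta> \<omega>}
      = ennreal (P.expectation (\<lambda>\<omega>. L q \<omega> * indicator (space ?P - T) \<omega>))" .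
  have diff: "(\<lambda>x. ?f x - f_null x) = trig (J q) (b q)" by simp
  have "?f \<in> dens_set" "trig (J q) (b q) \<in> ellipsoid (a q) R" "r (a q) \<le> L2norm (trig (J q) (b q))"
    using q(1) J b ell sep by (auto intro!: dens_set_trig trig_in_ellipsoid simp: L2norm_trig)
  then have mem: "?f \<in> {f\<in>dens_set. (\<lambda>x. f x - f_null x) \<in> ellipsoid (a q) R
                              \<and> L2norm (\<lambda>x. f x - f_null x) \<ge> r (a q)}"
    by (simp add: diff)
  have "ennreal (1 - \<beta>) \<le> ennreal (v q)" using q by (intro ennreal_leI)
  also have "\<dots> = ennreal (P.prob T) + ennreal (P.expectation (\<lambda>\<omega>. L q \<omega> * indicator (space ?P - T) \<omega>))"
    unfolding v_def using Lpos by (intro ennreal_plus) (auto intro!: Bochner_Integration.integral_nonneg)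
  also have "\<dots> \<le> risk n \<phi> \<Delta> (a q) R (r (a q))"
    unfolding risk_def joint_law_null[OF \<phi>] T_def[symmetric] P.emeasure_eq_measure em[symmetric]
    by (intro add_left_mono SUP_upper2[OF mem]) simp
  also have "\<dots> \<le> (SUP a\<in>\<A>. risk n \<phi> \<Delta> a R (r a))"
    using a[OF q(1)] by (intro SUP_upper)
  finally show ?thesis .
qed

subsection \<open>Separation radius and dyadic blocks\<close>

lemma nu_nonneg: "0 \<le> nu \<phi> k" by (simp add: nu_def)

lemma nu_pow4: "nu \<phi> k ^ 4 = (\<Sum>j\<in>{-int k..int k} - {0}. 1 / (cmod (fcoef \<phi> j)) ^ 4)"
proof -
  let ?s = "\<Sum>j\<in>{-int k..int k} - {0}. 1 / (cmod (fcoef \<phi> j)) ^ 4"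
  have "0 \<le> ?s" by (intro sum_nonneg) auto
  moreover have "nu \<phi> k ^ 4 = ?s powr (1/4 * 4)" if "?s > 0"
    using that unfolding nu_def by (subst powr_realpow[symmetric]) (auto simp: powr_powr)
  \<comment> \<open>The case \<open>?s = 0\<close> rests on the value
    \<open>0 powr (1/4) = 0\<close>.\<close>
  ultimately show ?thesis by (cases "?s = 0") (auto simp: nu_def)
qed

text \<open>Fourier coefficients of a density have modulus at most one, so the summand
  \<open>j = 1\<close> alone is at least one.\<close>

lemma nu_ge_1:
  assumes "\<phi> \<in> dens_set" "\<forall>j::int. cmod (fcoef \<phi> j) > 0" "1 \<le> k"
  shows "1 \<le> nu \<phi> k"
proof -
  have "1 \<le> 1 / (cmod (fcoef \<phi> 1)) ^ 4"
    using assms cmod_fcoef_dens_le_1[of \<phi> 1] by (simp add: power_le_one)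
  also have "\<dots> \<le> nu \<phi> k ^ 4"
    unfolding nu_pow4 using assms by (intro member_le_sum) auto
  finally show ?thesis
    using power_less_one_iff[of "nu \<phi> k" 4] nu_nonneg[of \<phi> k] by linarith
qed

text \<open>Each of the \<open>2 * k\<close> summands is at most the bound at the highest frequency,
  \<open>k powr (4 * p) / c ^ 4\<close>; conjugation symmetry transfers the decay to negative
  \<open>j\<close>.\<close>

lemma nu_pow4_le:
  assumes c: "0 < c" and lower: "\<And>j::nat. j \<ge> 1 \<Longrightarrow> c * real j powr (-p) \<le> cmod (fcoef \<phi> (int j))"
    and p: "0 \<le> p" and k: "1 \<le> k"
  shows "nu \<phi> k ^ 4 \<le> 2 / c ^ 4 * real k powr (4 * p + 1)"
proof -
  have "1 / (cmod (fcoef \<phi> j)) ^ 4 \<le> real k powr (4 * p) / c ^ 4" if j: "j \<in> {-int k..int k} - {0}" for j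
  proof -
    have "cmod (fcoef \<phi> j) = cmod (fcoef \<phi> (int (nat \<bar>j\<bar>)))"
      using fcoef_minus[of \<phi> j] by (cases "j \<ge> 0") auto
    then have "c * real (nat \<bar>j\<bar>) powr (-p) \<le> cmod (fcoef \<phi> j)"
      using lower[of "nat \<bar>j\<bar>"] j by auto
    moreover have "real k powr (-p) \<le> real (nat \<bar>j\<bar>) powr (-p)"
      using j p by (intro powr_mono2') auto
    then have "c * real k powr (-p) \<le> c * real (nat \<bar>j\<bar>) powr (-p)" using c by simp
    ultimately have "c * real k powr (-p) \<le> cmod (fcoef \<phi> j)" by linarith
    then have "(c * real k powr (-p)) ^ 4 \<le> cmod (fcoef \<phi> j) ^ 4"
      using c by (intro power_mono) auto
    then have "1 / cmod (fcoef \<phi> j) ^ 4 \<le> 1 / (c * real k powr (-p)) ^ 4"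
      using c k by (intro frac_le) auto
    also have "\<dots> = real k powr (4 * p) / c ^ 4"
      using k by (simp add: power_mult_distrib powr_power powr_minus field_simps)
    finally show ?thesis .
  qed
  then have "nu \<phi> k ^ 4 \<le> (\<Sum>j\<in>{-int k..int k} - {0}. real k powr (4 * p) / c ^ 4)"
    unfolding nu_pow4 by (rule sum_mono)
  also have "\<dots> = 2 / c ^ 4 * real k powr (4 * p + 1)"
    using k by (simp add: card_Diff_singleton powr_add of_nat_diff nat_add_distrib)
  finally show ?thesis .
qed

text \<open>The infimum is bounded by its value at \<open>k\<close>, where by assumption the second
  entry of the maximum dominates.\<close>

lemma rho_le:
  assumes "1 \<le> k" "0 < x" and a: "(a k)\<^sup>2 \<le> (nu \<phi> k)\<^sup>2 / x"
  shows "rho \<phi> a x \<le> nu \<phi> k / sqrt x"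
proof -
  have "(INF k\<in>{1..}. max ((a k)\<^sup>2) ((nu \<phi> k)\<^sup>2 / x)) \<le> max ((a k)\<^sup>2) ((nu \<phi> k)\<^sup>2 / x)"
    using assms by (intro cINF_lower bdd_belowI2[where m=0]) (auto simp: le_max_iff_disj)
  then have "rho \<phi> a x \<le> sqrt ((nu \<phi> k)\<^sup>2 / x)"
    unfolding rho_def using a by (intro real_sqrt_le_mono) auto
  then show ?thesis using nu_nonneg by (simp add: real_sqrt_divide)
qed

text \<open>Controls the diagonal exponent of the second moment, with \<open>y\<close> the sample
  size and \<open>x\<close> the reduced one. On the block \<open>cmod (fcoef \<phi> j)\<close> is at
  most of order \<open>l powr (-p)\<close>, and \<open>nu \<phi> (2 * l) ^ 4\<close> at most of
  order \<open>l powr (4 * p + 1)\<close>. With the \<open>l\<close> summands and the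
  \<open>l^2\<close> in the denominator of \<open>\<theta> ^ 4\<close> all powers of
  \<open>l\<close> cancel, so the bound is uniform in the level.\<close>

lemma block_sq_sum_le:
  fixes C c p :: real
  assumes c: "0 < c" and lower: "\<And>j::nat. j \<ge> 1 \<Longrightarrow> c * real j powr (-p) \<le> cmod (fcoef \<phi> (int j))"
    and upper: "\<And>j::nat. j \<ge> 1 \<Longrightarrow> cmod (fcoef \<phi> (int j)) \<le> C * real j powr (-p)"
    and p: "0 \<le> p" and l: "1 \<le> l" and x: "0 < x"
    and \<theta>: "\<theta>\<^sup>2 = B\<^sup>2 * (nu \<phi> (2 * l))\<^sup>2 / (x * real (2 * l))"
  shows "(\<Sum>j\<in>{l<..2*l}. (y * (2 * \<theta>\<^sup>2 * (cmod (fcoef \<phi> (int j)))\<^sup>2))\<^sup>2) / 2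
    \<le> (2 * (C / c) ^ 4 * 2 powr (4 * p)) * B ^ 4 * (y / x)\<^sup>2"
proof -
  have C: "0 \<le> C" using lower[of 1] upper[of 1] c by simp
  have "(cmod (fcoef \<phi> (int j))) ^ 4 \<le> C ^ 4 * real l powr (- (4 * p))" if j: "j \<in> {l<..2*l}" for j
  proof -
    have "cmod (fcoef \<phi> (int j)) \<le> C * real j powr (-p)" using upper[of j] j by auto
    also have "\<dots> \<le> C * real l powr (-p)" using j l C p by (intro mult_left_mono powr_mono2') auto
    finally have "(cmod (fcoef \<phi> (int j))) ^ 4 \<le> (C * real l powr (-p)) ^ 4" by (intro power_mono) auto
    then show ?thesis using l by (simp add: power_mult_distrib powr_power mult.commute)
  qed
  then have "(\<Sum>j\<in>{l<..2*l}. (cmod (fcoef \<phi> (int j))) ^ 4) \<le> (\<Sum>j\<in>{l<..2*l}. C ^ 4 * real l powr (- (4 * p)))"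
    by (rule sum_mono)
  also have "\<dots> = real l * (C ^ 4 * real l powr (- (4 * p)))" by simp
  finally have S: "(\<Sum>j\<in>{l<..2*l}. (cmod (fcoef \<phi> (int j))) ^ 4) \<le> real l * (C ^ 4 * real l powr (- (4 * p)))" .
  have th4: "\<theta> ^ 4 = B ^ 4 * nu \<phi> (2 * l) ^ 4 / (x\<^sup>2 * (4 * (real l)\<^sup>2))"
  proof -
    have "\<theta> ^ 4 = (\<theta>\<^sup>2)\<^sup>2" by simp
    also have "\<dots> = B ^ 4 * nu \<phi> (2 * l) ^ 4 / (x\<^sup>2 * (4 * (real l)\<^sup>2))"
      unfolding \<theta> by (simp add: power_divide power_mult_distrib flip: power_mult)
    finally show ?thesis .
  qed
  have "nu \<phi> (2*l) ^ 4 \<le> 2 / c ^ 4 * real (2*l) powr (4 * p + 1)"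
    using c lower p l by (intro nu_pow4_le) auto
  also have "\<dots> = 4 / c ^ 4 * 2 powr (4 * p) * real l powr (4 * p) * real l"
    using l by (simp add: powr_mult powr_add)
  finally have nu4: "nu \<phi> (2*l) ^ 4 \<le> 4 / c ^ 4 * 2 powr (4 * p) * real l powr (4 * p) * real l" .
  have "(\<Sum>j\<in>{l<..2*l}. (y * (2 * \<theta>\<^sup>2 * (cmod (fcoef \<phi> (int j)))\<^sup>2))\<^sup>2) / 2
     = 2 * y\<^sup>2 * \<theta> ^ 4 * (\<Sum>j\<in>{l<..2*l}. (cmod (fcoef \<phi> (int j))) ^ 4)"
    by (simp add: sum_distrib_left sum_divide_distrib power_mult_distrib mult_ac flip: power_mult)
  also have "\<dots> \<le> 2 * y\<^sup>2 * \<theta> ^ 4 * (real l * (C ^ 4 * real l powr (- (4 * p))))"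
    by (intro mult_left_mono S) auto
  also have "\<dots> = (2 * y\<^sup>2 * B ^ 4 / (x\<^sup>2 * (4 * (real l)\<^sup>2)) * (real l * (C ^ 4 * real l powr (- (4 * p))))) * nu \<phi> (2*l) ^ 4"
    unfolding th4 by simp
  also have "\<dots> \<le> (2 * y\<^sup>2 * B ^ 4 / (x\<^sup>2 * (4 * (real l)\<^sup>2)) * (real l * (C ^ 4 * real l powr (- (4 * p))))) *
      (4 / c ^ 4 * 2 powr (4 * p) * real l powr (4 * p) * real l)"
    by (intro mult_left_mono nu4) auto
  also have "\<dots> = (2 * (C / c) ^ 4 * 2 powr (4 * p)) * B ^ 4 * (y / x)\<^sup>2"
    using l x c by (simp add: powr_minus power_divide field_simps power2_eq_square)
  finally show ?thesis .
qed

section \<open>Growth comparisons in the sample size\<close>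

lemma eventually_ln_powr_le_scaled_sqrt:
  fixes K q :: real
  shows "eventually (\<lambda>n::nat. K * ln (real n) powr q \<le> max (ln (ln (ln (real n)))) 1 powr (-1/2) * sqrt (real n)) sequentially"
  by real_asymp

lemma eventually_ln_powr_le_sqrt:
  fixes K q :: real
  shows "eventually (\<lambda>n::nat. K * ln (real n) powr q \<le> sqrt (real n)) sequentially"
  by real_asymp

text \<open>For large \<open>n\<close> the left side is \<open>sqrt (ln (ln n))\<close>, which any
  positive multiple of \<open>ln (ln n)\<close> eventually exceeds. The triple logarithm thus lets
  the diagonal term be absorbed by the number of levels.\<close>

lemma eventually_exp_lnlnln_le_lnln:
  fixes c1 c2 :: real
  assumes "c1 > 0"
  shows "eventually (\<lambda>n::nat. exp (max (ln (ln (ln (real n)))) 1 / 2) \<le> c1 * ln (ln (real n)) - c2) sequentially"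
  using assms by real_asymp

lemma powr_ln_ratio:
  fixes k y :: real
  assumes k: "1 < k" and y: "0 < y"
  shows "k powr (ln y / ln k) = y"
  using assms by (simp add: powr_def)

theorem theorem6p3:
  fixes \<phi> :: "real \<Rightarrow> real" and p R s_lo s_hi :: real
    and \<A> :: "(nat \<Rightarrow> real) set"
  assumes phi_dens: "\<phi> \<in> dens_set"
    and phi_nz: "\<forall>j::int. cmod (fcoef \<phi> j) > 0"
    and phi_decay: "\<exists>c C. 0 < c \<and> c \<le> C \<and>
        (\<forall>j::nat. j \<ge> 1 \<longrightarrow> c * real j powr (-p) \<le> cmod (fcoef \<phi> (int j))
                              \<and> cmod (fcoef \<phi> (int j)) \<le> C * real j powr (-p))"
    and p_gt: "p > 1/2"
    and R_pos: "R > 0"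
    and s_bounds: "0 < s_lo" "s_lo < s_hi"
    and A_seq: "\<forall>a\<in>\<A>. \<forall>j\<ge>1. 0 < a j \<and> a j \<le> 1 \<and> a (Suc j) \<le> a j"
    and A_contains: "\<forall>s\<in>{s_lo..s_hi}. (\<lambda>j::nat. exp (- (real j powr s))) \<in> \<A>"
  shows "\<forall>\<alpha>\<in>{0<..<1::real}. \<exists>n0::nat. \<exists>Abar::real. Abar > 0 \<and>
           (\<forall>n\<ge>n0. \<forall>Aamp\<in>{0..Abar}.
              (INF \<Delta>\<in>tests n. SUP a\<in>\<A>.
                 risk n \<phi> \<Delta> a R
                   (Aamp * rho \<phi> a ((max (ln (ln (ln (real n)))) 1) powr (-1/2) * real n)))
              \<ge> ennreal (1 - \<alpha>))"
proof

  \<comment> \<open>Constants independent of the sample size\<close>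
  fix \<alpha> :: real assume \<alpha>: "\<alpha> \<in> {0<..<1}"
  obtain c C where c: "0 < c" "c \<le> C"
    and lower: "\<And>j::nat. j \<ge> 1 \<Longrightarrow> c * real j powr (-p) \<le> cmod (fcoef \<phi> (int j))"
    and upper: "\<And>j::nat. j \<ge> 1 \<Longrightarrow> cmod (fcoef \<phi> (int j)) \<le> C * real j powr (-p)"
    using phi_decay by blast
  define G where "G = 2 * (C / c) ^ 4 * 2 powr (4 * p)"
  have G: "G > 0" using c by (simp add: G_def)
  \<comment> \<open>\<open>B\<close> scales the perturbations and also serves as
    \<open>Abar\<close>: \<open>B <= R\<close> yields the ellipsoid condition, and the other two
    bounds give \<open>G * B ^ 4 <= G * B <= 1/2\<close>.\<close>
  define B where "B = min R (min 1 (1 / (2 * G)))"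
  have B: "0 < B" "B \<le> R" "B \<le> 1" "B \<le> 1 / (2 * G)" using R_pos G by (auto simp: B_def)
  have GB: "G * B ^ 4 \<le> 1 / 2"
  proof -
    have "B ^ 4 \<le> B ^ 1" using B by (intro power_decreasing) auto
    then have "G * B ^ 4 \<le> G * (1 / (2 * G))" using B G by (intro mult_left_mono) auto
    then show ?thesis using G by simp
  qed
  \<comment> \<open>\<open>c1 * ln (ln n) - c2\<close> will bound the number of levels from below.
    The \<open>1\<close> in \<open>c2\<close> is the net loss from rounding both ends of the range
    inward.\<close>
  define c1 where "c1 = 1 / (s_lo * ln 2) - 1 / (s_hi * ln 2)"
  define c2 where "c2 = ln 4 / (s_lo * ln 2) + 1"
  have c1: "c1 > 0" using s_bounds by (simp add: c1_def field_simps)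
  \<comment> \<open>In order: positivity of \<open>ln (ln n)\<close>; the bound of
    \<open>\<nu>^2\<close> by \<open>d * sqrt n\<close>; nonnegativity of the perturbed densities;
    enough levels to absorb the diagonal term; positivity of \<open>ln n\<close>.\<close>
  have "eventually (\<lambda>n::nat. ln 4 < ln (ln (real n))
      \<and> 2 / c ^ 4 * ln (real n) powr ((4 * p + 1) / s_lo) \<le> max (ln (ln (ln (real n)))) 1 powr (-1/2) * sqrt (real n)
      \<and> B\<^sup>2 * ln (real n) powr (1 / s_lo) \<le> sqrt (real n)
      \<and> exp (max (ln (ln (ln (real n)))) 1 / 2) \<le> \<alpha>\<^sup>2 * c1 * ln (ln (real n)) - \<alpha>\<^sup>2 * c2
      \<and> 3 \<le> n) sequentially"
    using c1 \<alpha> by (intro eventually_conj eventually_ln_powr_le_scaled_sqrt eventually_ln_powr_le_sqrt eventually_exp_lnlnln_le_lnln eventually_ge_at_top) (real_asymp | simp)+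
  then obtain n0 where n0: "\<And>n. n \<ge> n0 \<Longrightarrow> ln 4 < ln (ln (real n))"
    "\<And>n. n \<ge> n0 \<Longrightarrow> 2 / c ^ 4 * ln (real n) powr ((4 * p + 1) / s_lo) \<le> max (ln (ln (ln (real n)))) 1 powr (-1/2) * sqrt (real n)"
    "\<And>n. n \<ge> n0 \<Longrightarrow> B\<^sup>2 * ln (real n) powr (1 / s_lo) \<le> sqrt (real n)"
    "\<And>n. n \<ge> n0 \<Longrightarrow> exp (max (ln (ln (ln (real n)))) 1 / 2) \<le> \<alpha>\<^sup>2 * c1 * ln (ln (real n)) - \<alpha>\<^sup>2 * c2"
    "\<And>n. n \<ge> n0 \<Longrightarrow> 3 \<le> n"
    unfolding eventually_sequentially by blast
  show "\<exists>n0::nat. \<exists>Abar::real. Abar > 0 \<and>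
           (\<forall>n\<ge>n0. \<forall>Aamp\<in>{0..Abar}.
              (INF \<Delta>\<in>tests n. SUP a\<in>\<A>.
                 risk n \<phi> \<Delta> a R
                   (Aamp * rho \<phi> a ((max (ln (ln (ln (real n)))) 1) powr (-1/2) * real n)))
              \<ge> ennreal (1 - \<alpha>))"
  proof (intro exI[of _ n0] exI[of _ B] conjI allI impI ballI INF_greatest)
    show "B > 0" by (rule B)
  next
    fix n :: nat and Aamp :: real and \<Delta>
    assume n: "n0 \<le> n" and A: "Aamp \<in> {0..B}" and \<Delta>: "\<Delta> \<in> tests n"

    \<comment> \<open>Reduced sample size and range of levels\<close>
    define \<Lambda> where "\<Lambda> = max (ln (ln (ln (real n)))) 1"
    define d where "d = \<Lambda> powr (-1/2)"
    define x where "x = d * real n"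
    define L where "L = ln (ln (real n))"
    have n3: "3 \<le> n" using n0(5)[OF n] .
    have \<Lambda>: "1 \<le> \<Lambda>" by (simp add: \<Lambda>_def)
    have d: "0 < d" "d \<le> 1" using \<Lambda> unfolding d_def by (auto intro: powr_le_one_le simp: powr_minus_divide ge_one_powr_ge_zero)
    have lnn: "0 < ln (real n)" using n3 by simp
    have L: "ln 4 < L" "exp L = ln (real n)" using n0(1)[OF n] lnn by (auto simp: L_def)
    have L0: "0 < L" using L(1) ln_gt_zero[of "4::real"] by linarith
    have x: "0 < x" "x \<le> real n" using d n3 by (auto simp: x_def mult_left_le_one_le)
    have nx: "(real n / x)\<^sup>2 = \<Lambda>"
      using d n3 \<Lambda> unfolding x_def d_def
      by (simp add: power_divide power_mult_distrib powr_power powr_minus divide_simps)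
    \<comment> \<open>The endpoints encode \<open>2^m >= (ln n) powr (1 / s_hi)\<close> and
      \<open>2^m <= (ln n / 4) powr (1 / s_lo)\<close>. The factor \<open>4\<close> matches the
      lower bound \<open>ln n / 4\<close> on the value of \<open>k powr s\<close> prescribed at
      level \<open>k = 2^m\<close>, so that these conditions force \<open>s\<close> into the given
      interval.\<close>
    define I where "I = {nat \<lceil>L / (s_hi * ln 2)\<rceil>..nat \<lfloor>(L - ln 4) / (s_lo * ln 2)\<rfloor>}"
    have "c1 * L - c2 \<le> real (card I)"
    proof -
      have "0 \<le> L / (s_hi * ln 2)" using L0 s_bounds by auto
      then have u: "real (nat \<lceil>L / (s_hi * ln 2)\<rceil>) \<le> L / (s_hi * ln 2) + 1" by linarith
      have v: "(L - ln 4) / (s_lo * ln 2) - 1 \<le> real (nat \<lfloor>(L - ln 4) / (s_lo * ln 2)\<rfloor>)" by linarith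
      have "real (nat \<lfloor>(L - ln 4) / (s_lo * ln 2)\<rfloor>) + 1 - real (nat \<lceil>L / (s_hi * ln 2)\<rceil>) \<le> real (card I)"
        unfolding I_def by simp
      moreover have "c1 * L - c2 = ((L - ln 4) / (s_lo * ln 2) - 1) - L / (s_hi * ln 2)"
        unfolding c1_def c2_def by (simp add: diff_divide_distrib algebra_simps)
      ultimately show ?thesis using u v by linarith
    qed
    then have "\<alpha>\<^sup>2 * (c1 * L - c2) \<le> \<alpha>\<^sup>2 * real (card I)" by (intro mult_left_mono) auto
    then have cardI: "exp (\<Lambda> / 2) \<le> \<alpha>\<^sup>2 * real (card I)"
      using n0(4)[OF n] unfolding L_def \<Lambda>_def by (simp add: algebra_simps)
    have I: "finite I" "I \<noteq> {}"
    proof -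
      show "finite I" by (simp add: I_def)
      show "I \<noteq> {}"
      proof
        assume "I = {}"
        with cardI have "exp (\<Lambda> / 2) \<le> 0" by simp
        then show False by (simp add: not_le[symmetric])
      qed
    qed
    have DI: "exp (\<Lambda> / 2) / real (card I) \<le> \<alpha>\<^sup>2"
      using I cardI by (simp add: card_gt_0_iff divide_le_eq)

    \<comment> \<open>Block, amplitude and smoothness of each level\<close>
    define l where "l m = (2::nat) ^ (m - 1)" for m :: nat
    define J where "J m = {l m<..2 * l m}" for m
    define \<nu> where "\<nu> m = nu \<phi> (2 * l m)" for m
    define s where "s m = ln (ln (x / (\<nu> m)\<^sup>2) / 2) / ln (real (2 * l m))" for m
    define \<theta> where "\<theta> m = B * \<nu> m / sqrt (x * real (2 * l m))" for m
    define a where "a m j = exp (- (real j powr s m))" for m j :: nat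
    have l1: "1 \<le> l m" for m by (simp add: l_def)
    have \<nu>1: "1 \<le> \<nu> m" for m unfolding \<nu>_def using l1[of m] by (intro nu_ge_1 phi_dens phi_nz) auto
    have \<theta>0: "0 \<le> \<theta> m" for m unfolding \<theta>_def using B(1) \<nu>1[of m] x by simp
    have \<theta>2: "(\<theta> m)\<^sup>2 = B\<^sup>2 * (\<nu> m)\<^sup>2 / (x * real (2 * l m))" for m
      unfolding \<theta>_def using x by (simp add: power_divide power_mult_distrib)
    \<comment> \<open>The left side is the squared norm of a perturbation at level \<open>m\<close>:
      \<open>l m\<close> frequencies, each counted with its negative.\<close>
    have k\<theta>2: "2 * (real (l m) * (\<theta> m)\<^sup>2) = B\<^sup>2 * (\<nu> m)\<^sup>2 / x" for m
      unfolding \<theta>2 using x l1[of m] by (simp add: field_simps)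
    have m1: "1 \<le> m" if "m \<in> I" for m
    proof -
      have "0 < L / (s_hi * ln 2)" using L0 s_bounds by auto
      then have "1 \<le> nat \<lceil>L / (s_hi * ln 2)\<rceil>" by linarith
      moreover have "nat \<lceil>L / (s_hi * ln 2)\<rceil> \<le> m" using that by (simp add: I_def del: nat_le_iff)
      ultimately show ?thesis by linarith
    qed
    \<comment> \<open>Positivity of \<open>m\<close> matters: truncated subtraction gives
      \<open>l 0 = 1\<close>, hence \<open>2 * l 0 = 2\<close>.\<close>
    have twol: "2 * l m = 2 ^ m" if "m \<in> I" for m
      using m1[OF that] by (simp add: l_def flip: power_Suc)
    have pw: "real (2 * l m) powr t = exp (t * (real m * ln 2))" if "m \<in> I" for m t
      unfolding twol[OF that] by (simp add: powr_def ln_realpow)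
    have hi: "ln (real n) \<le> real (2 * l m) powr s_hi" if "m \<in> I" for m
    proof -
      have "L / (s_hi * ln 2) \<le> real m" using that by (simp add: I_def nat_le_iff ceiling_le_iff)
      then have "L \<le> s_hi * (real m * ln 2)" using s_bounds by (simp add: field_simps)
      then show ?thesis unfolding pw[OF that] L(2)[symmetric] by simp
    qed
    have lo: "real (2 * l m) powr s_lo \<le> ln (real n) / 4" if "m \<in> I" for m
    proof -
      have "m \<le> nat \<lfloor>(L - ln 4) / (s_lo * ln 2)\<rfloor>" using that by (simp add: I_def)
      then have "real m \<le> (L - ln 4) / (s_lo * ln 2)" using m1[OF that] by linarith
      then have "s_lo * (real m * ln 2) \<le> L - ln 4" using s_bounds by (simp add: field_simps)
      then have "exp (s_lo * (real m * ln 2)) \<le> exp (L - ln 4)" by simp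
      then show ?thesis unfolding pw[OF that] by (simp add: exp_diff L(2))
    qed
    have kle: "real (2 * l m) \<le> ln (real n) powr (1 / s_lo)" if "m \<in> I" for m
    proof -
      have "(real (2 * l m) powr s_lo) powr (1 / s_lo) \<le> ln (real n) powr (1 / s_lo)"
        using lo[OF that] lnn s_bounds by (intro powr_mono2) auto
      then show ?thesis using s_bounds l1[of m] by (simp add: powr_powr)
    qed
    have \<nu>2: "(\<nu> m)\<^sup>2 \<le> d * sqrt (real n)" if m: "m \<in> I" for m
    proof -
      have "(\<nu> m)\<^sup>2 \<le> \<nu> m ^ 4" using \<nu>1[of m] by (intro power_increasing) auto
      also have "\<dots> \<le> 2 / c ^ 4 * real (2 * l m) powr (4 * p + 1)"
        unfolding \<nu>_def using c lower p_gt l1[of m] by (intro nu_pow4_le) auto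
      also have "\<dots> \<le> 2 / c ^ 4 * (ln (real n) powr (1 / s_lo)) powr (4 * p + 1)"
        using kle[OF m] c p_gt by (intro mult_left_mono powr_mono2) auto
      also have "\<dots> \<le> d * sqrt (real n)"
        using n0(2)[OF n] by (simp add: powr_powr d_def \<Lambda>_def)
      finally show ?thesis .
    qed
    \<comment> \<open>\<open>\<nu>2\<close> gives \<open>x / \<nu>^2 >= sqrt n\<close>, and
      \<open>\<nu> >= 1\<close> gives \<open>x / \<nu>^2 <= n\<close>; take logarithms.\<close>
    have ypos: "ln (real n) / 4 \<le> ln (x / (\<nu> m)\<^sup>2) / 2 \<and> ln (x / (\<nu> m)\<^sup>2) / 2 \<le> ln (real n)" if m: "m \<in> I" for m
    proof -
      have n0: "0 < \<nu> m" using \<nu>1[of m] by linarith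
      have "x = sqrt (real n) * (d * sqrt (real n))" by (simp add: x_def)
      then have "sqrt (real n) * (\<nu> m)\<^sup>2 \<le> x" using \<nu>2[OF m] by (simp add: mult_left_mono)
      then have "sqrt (real n) \<le> x / (\<nu> m)\<^sup>2" using n0 by (simp add: field_simps)
      then have "ln (sqrt (real n)) \<le> ln (x / (\<nu> m)\<^sup>2)" using n3 x n0 by (subst ln_le_cancel_iff) auto
      moreover have "ln (sqrt (real n)) = ln (real n) / 2" using n3 by (simp add: ln_sqrt)
      moreover have "x / (\<nu> m)\<^sup>2 \<le> x / 1" using \<nu>1[of m] x by (intro divide_left_mono) auto
      then have "ln (x / (\<nu> m)\<^sup>2) \<le> ln (real n)" using n3 x n0 by (subst ln_le_cancel_iff) auto
      ultimately show ?thesis using lnn by linarith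
    qed
    have ks: "real (2 * l m) powr s m = ln (x / (\<nu> m)\<^sup>2) / 2" if m: "m \<in> I" for m
      unfolding s_def using ypos[OF m] lnn l1[of m] by (intro powr_ln_ratio) auto
    \<comment> \<open>By \<open>lo\<close>, \<open>ypos\<close> and \<open>hi\<close>, the power
      with exponent \<open>s m\<close> lies between those with exponents \<open>s_lo\<close> and
      \<open>s_hi\<close>, and the base exceeds one.\<close>
    have sI: "s m \<in> {s_lo..s_hi}" if m: "m \<in> I" for m
    proof -
      have "real (2 * l m) powr s_lo \<le> real (2 * l m) powr s m" "real (2 * l m) powr s m \<le> real (2 * l m) powr s_hi"
        unfolding ks[OF m] using ypos[OF m] lo[OF m] hi[OF m] by linarith+
      moreover have "1 < real (2 * l m)" using l1[of m] by simp
      ultimately show ?thesis by simp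
    qed
    have sA: "a m \<in> \<A>" if "m \<in> I" for m
      using A_contains sI[OF that] unfolding a_def[abs_def] by blast
    \<comment> \<open>The choice of \<open>s m\<close> balances the two entries of the maximum in
      \<open>rho\<close> at \<open>k = 2 * l m\<close>.\<close>
    have ak: "(a m (2 * l m))\<^sup>2 = (\<nu> m)\<^sup>2 / x" if m: "m \<in> I" for m
    proof -
      have n0: "0 < \<nu> m" using \<nu>1[of m] by linarith
      have "(a m (2 * l m))\<^sup>2 = exp (- ln (x / (\<nu> m)\<^sup>2))"
        unfolding a_def ks[OF m] by (simp flip: exp_double)
      also have "\<dots> = (\<nu> m)\<^sup>2 / x" using n0 x by (simp add: exp_minus)
      finally show ?thesis .
    qed
    \<comment> \<open>The sequence decreases, so on the block its value at the right end can replace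
      all others in the ellipsoid sum.\<close>
    have amono: "a m (2 * l m) \<le> a m j" if m: "m \<in> I" and j: "j \<in> J m" for m j
    proof -
      have "0 \<le> s m" using sI[OF m] s_bounds by auto
      then show ?thesis using j unfolding a_def J_def by (auto intro!: powr_mono2)
    qed

    \<comment> \<open>Prior over levels and signs, and its second moment\<close>
    define b where "b q j = complex_of_real (\<theta> (fst q) * snd q j)" for q :: "nat \<times> (nat \<Rightarrow> real)" and j
    define Q where "Q = (SIGMA m:I. \<Pi>\<^sub>E j\<in>J m. {-1, 1::real})"
    define w where "w = (\<lambda>q::nat \<times> (nat \<Rightarrow> real). 1 / (real (card I) * 2 ^ card (J (fst q))))"
    define t where "t m j = real n * (2 * (\<theta> m)\<^sup>2 * (cmod (fcoef \<phi> (int j)))\<^sup>2)" for m j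
    define E where "E q q' = real n * (\<Sum>j\<in>J (fst q) \<inter> J (fst q').
        2 * Re (b q j * cnj (b q' j)) * (cmod (fcoef \<phi> (int j)))\<^sup>2)" for q q'
    have cb: "cmod (b q j) = \<theta> (fst q)" if "q \<in> Q" "j \<in> J (fst q)" for q j
    proof -
      have "snd q j \<in> {-1, 1}" using that unfolding Q_def by auto
      then show ?thesis using \<theta>0[of "fst q"] by (auto simp: b_def)
    qed
    have fstQ: "fst q \<in> I" if "q \<in> Q" for q using that by (auto simp: Q_def)
    have finJ: "finite (J m)" "0 \<notin> J m" for m by (auto simp: J_def)
    have cardJ: "card (J m) = l m" for m by (simp add: J_def)
    \<comment> \<open>The blocks are the dyadic intervals \<open>(2^(m-1), 2^m]\<close>: a lower one
      ends at or before the excluded left end of a higher one.\<close>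
    have disj: "J m \<inter> J m' = {}" if "m \<in> I" "m' \<in> I" "m \<noteq> m'" for m m'
    proof -
      have *: "J m \<inter> J m' = {}" if "m < m'" "m \<in> I" for m m'
      proof -
        have "2 * l m \<le> l m'" unfolding twol[OF that(2)] unfolding l_def using that by (intro power_increasing) auto
        then show ?thesis by (auto simp: J_def)
      qed
      show ?thesis using that *[of m m'] *[of m' m] by (cases "m < m'") auto
    qed
    have off: "E (m, \<epsilon>) (m', \<epsilon>') = 0" if "m \<in> I" "m' \<in> I" "m \<noteq> m'" for m m' \<epsilon> \<epsilon>'
      unfolding E_def using disj[OF that] by simp
    have diag: "E (m, \<epsilon>) (m, \<epsilon>') = (\<Sum>j\<in>J m. \<epsilon>' j * \<epsilon> j * t m j)" for m \<epsilon> \<epsilon>'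
      unfolding E_def t_def b_def by (simp add: sum_distrib_left power2_eq_square mult_ac)
    \<comment> \<open>The factor \<open>(n / x)^2 = \<Lambda>\<close> is the price of the reduced
      sample size; \<open>GB\<close> keeps its coefficient at most \<open>1/2\<close>.\<close>
    have D: "exp ((\<Sum>j\<in>J m. (t m j)\<^sup>2) / 2) \<le> exp (\<Lambda> / 2)" for m
    proof -
      have "(\<Sum>j\<in>J m. (t m j)\<^sup>2) / 2 \<le> G * B ^ 4 * (real n / x)\<^sup>2"
        unfolding t_def J_def G_def using c lower upper p_gt l1 x \<theta>2[of m]
        by (intro block_sq_sum_le) (auto simp: \<nu>_def)
      also have "\<dots> \<le> 1 / 2 * (real n / x)\<^sup>2" by (intro mult_right_mono GB) simp
      finally show ?thesis unfolding nx by simp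
    qed
    have mix: "sum w Q = 1" "(\<Sum>q\<in>Q. \<Sum>q'\<in>Q. w q * w q' * exp (E q q')) \<le> 1 + exp (\<Lambda> / 2) / real (card I)"
      unfolding w_def Q_def
      by (rule sum_block_mixture_le[where E=E and t=t and J=J and D="exp (\<Lambda> / 2)", OF I finJ(1)];
          (rule off diag D; assumption))+

    \<comment> \<open>Verification that the prior is admissible\<close>
    have "ennreal (1 - \<alpha>) \<le> (SUP a\<in>\<A>. risk n \<phi> \<Delta> a R (Aamp * rho \<phi> a x))"
    proof (rule SUP_risk_ge_mixture[where Q=Q and w=w and J="\<lambda>q. J (fst q)" and b=b and a="\<lambda>q. a (fst q)"
          and r="\<lambda>a. Aamp * rho \<phi> a x"])
      show "finite Q" unfolding Q_def using I finJ by (intro finite_SigmaI finite_PiE) auto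
      show "0 < \<alpha>" using \<alpha> by simp
      show "sum w Q = 1" by (rule mix)
      show "(\<Sum>q\<in>Q. \<Sum>q'\<in>Q. w q * w q' * exp (real n * (\<Sum>j\<in>J (fst q) \<inter> J (fst q').
        2 * Re (b q j * cnj (b q' j)) * (cmod (fcoef \<phi> (int j)))\<^sup>2))) \<le> 1 + \<alpha>\<^sup>2"
        using mix(2) DI unfolding E_def by linarith
    next
      fix q assume q: "q \<in> Q"
      let ?m = "fst q"
      have m: "?m \<in> I" by (rule fstQ[OF q])
      have n0': "0 < \<nu> ?m" using \<nu>1[of ?m] by linarith
      show "a ?m \<in> \<A>" by (rule sA[OF m])
      \<comment> \<open>With \<open>k = 2 * l ?m\<close> the left side is
        \<open>k * \<theta>\<close>, whose square is \<open>B^2 * k * \<nu>^2 / x\<close>. Here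
        \<open>B^2 * k <= sqrt n\<close> since \<open>k\<close> is at most a power of
        \<open>ln n\<close>, and \<open>\<nu>^2 <= d * sqrt n\<close>; the product of these bounds
        is \<open>x\<close>.\<close>
      show "2 * (\<Sum>j\<in>J ?m. cmod (b q j)) \<le> 1"
      proof -
        have "(real (2 * l ?m) * \<theta> ?m)\<^sup>2 = (B\<^sup>2 * real (2 * l ?m)) * (\<nu> ?m)\<^sup>2 / x"
          unfolding power_mult_distrib \<theta>2 using x l1[of ?m] by (simp add: field_simps power2_eq_square)
        also have "\<dots> \<le> sqrt (real n) * (d * sqrt (real n)) / x"
        proof (intro divide_right_mono mult_mono \<nu>2[OF m])
          have "B\<^sup>2 * real (2 * l ?m) \<le> B\<^sup>2 * ln (real n) powr (1 / s_lo)"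
            by (intro mult_left_mono kle[OF m]) simp
          then show "B\<^sup>2 * real (2 * l ?m) \<le> sqrt (real n)" using n0(3)[OF n] by linarith
        qed (use x in auto)
        also have "\<dots> = 1" using x d by (simp add: x_def)
        finally have "real (2 * l ?m) * \<theta> ?m \<le> 1" by (simp add: power_le_one_iff abs_square_le_1)
        then show ?thesis by (simp add: cb[OF q] cardJ)
      qed
      \<comment> \<open>Replacing every \<open>a j\<close> by its smallest value on the block turns
        the sum into \<open>B^2\<close>, because the squared norm \<open>B^2 * \<nu>^2 / x\<close>
        is divided by \<open>\<nu>^2 / x\<close>.\<close>
      show "2 * (\<Sum>j\<in>J ?m. (cmod (b q j))\<^sup>2 / (a ?m j)\<^sup>2) \<le> R\<^sup>2"
      proof -
        have "(\<Sum>j\<in>J ?m. (cmod (b q j))\<^sup>2 / (a ?m j)\<^sup>2) \<le> (\<Sum>j\<in>J ?m. (\<theta> ?m)\<^sup>2 / (a ?m (2 * l ?m))\<^sup>2)"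
        proof (rule sum_mono)
          fix j assume j: "j \<in> J ?m"
          have "0 < a ?m (2 * l ?m)" by (simp add: a_def)
          then show "(cmod (b q j))\<^sup>2 / (a ?m j)\<^sup>2 \<le> (\<theta> ?m)\<^sup>2 / (a ?m (2 * l ?m))\<^sup>2"
            unfolding cb[OF q j] using amono[OF m j] by (intro divide_left_mono power_mono) auto
        qed
        also have "2 * \<dots> = (2 * (real (l ?m) * (\<theta> ?m)\<^sup>2)) / (a ?m (2 * l ?m))\<^sup>2"
          by (simp add: cardJ)
        also have "\<dots> = B\<^sup>2" unfolding k\<theta>2 ak[OF m] using n0' x by simp
        also have "B\<^sup>2 \<le> R\<^sup>2" using B by (intro power_mono) auto
        finally show ?thesis by simp
      qed
      \<comment> \<open>The norm of the perturbation equals \<open>B * \<nu> / sqrt x\<close>, that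
        is, \<open>B\<close> times the bound on \<open>rho\<close> from \<open>rho_le\<close>;
        \<open>Aamp <= B\<close> finishes the comparison.\<close>
      show "Aamp * rho \<phi> (a ?m) x \<le> sqrt (2 * (\<Sum>j\<in>J ?m. (cmod (b q j))\<^sup>2))"
      proof -
        have "rho \<phi> (a ?m) x \<le> \<nu> ?m / sqrt x"
          unfolding \<nu>_def using ak[OF m] x l1[of ?m] by (intro rho_le) (auto simp: \<nu>_def)
        then have "Aamp * rho \<phi> (a ?m) x \<le> Aamp * (\<nu> ?m / sqrt x)"
          using A by (intro mult_left_mono) auto
        also have "\<dots> \<le> B * (\<nu> ?m / sqrt x)" using A n0' x by (intro mult_right_mono) auto
        also have "\<dots> = sqrt (B\<^sup>2 * (\<nu> ?m)\<^sup>2 / x)"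
          using B n0' by (simp add: real_sqrt_divide real_sqrt_mult)
        also have "\<dots> = sqrt (2 * (\<Sum>j\<in>J ?m. (cmod (b q j))\<^sup>2))"
          by (simp add: cb[OF q] cardJ k\<theta>2[symmetric])
        finally show ?thesis .
      qed
    qed (use phi_dens \<Delta> finJ in \<open>auto simp: w_def\<close>)
    then show "ennreal (1 - \<alpha>) \<le> (SUP a\<in>\<A>. risk n \<phi> \<Delta> a R
                   (Aamp * rho \<phi> a ((max (ln (ln (ln (real n)))) 1) powr (-1/2) * real n)))"
      unfolding x_def d_def \<Lambda>_def .
  qed
qed

end
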